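(* Let $(\Gamma,\mu)$ be a weighted graph satisfying condition $(\overline E)$: there is $C>0$ such that $\overline{E}(x,R)\le C\,E(x,R)$ for all $x\in\Gamma$ and $R>0$. Then there are constants $q>0$ (the constant used in the definition of $\kappa$) and $c>0$ such that for all nonempty sets $A,B\subset\Gamma$ and all integers $n\ge1$, $$\sum_{x\in A,\,y\in B}p_n(x,y)\,\mu(x)\mu(y)\le\left[\mu(A)\mu(B)\right]^{1/2}\exp\left(-c\,\kappa(n,A,B)\right).$$
   Context: $\Gamma$ is a countable infinite connected (locally finite) graph with symmetric weights $\mu_{x,y}=\mu_{y,x}>0$ on edges $x\sim y$; $\mu(x)=\sum_{y\sim x}\mu_{x,y}$ and $\mu(A)=\sum_{y\in A}\mu(y)$. $d$ is the graph distance and $B(x,R)=\{y\in\Gamma:d(x,y)<R\}$. $X_n$ is the reversible Markov chain on $\Gamma$ with transition probabilities $P(x,y)=\mu_{x,y}/\mu(x)$; $P_n(x,y)=\mathbb P(X_n=y\mid X_0=x)$ and $p_n(x,y)=P_n(x,y)/\mu(y)$. Exit times: $T_A=\min\{k\ge0:X_k\in\Gamma\setminus A\}$, $E_x(A)=\mathbb E(T_A\mid X_0=x)$, $E(x,R)=E_x(B(x,R))$ (so $E(x,0)=0$), $\overline E(A)=\max_{x\in A}E_x(A)$, $\overline E(x,R)=\overline E(B(x,R))$. Sub-Gaussian kernel: fix a constant $q>0$. For $z\in\Gamma$, $n\ge1$ and $R\geq 0$ let $k_z(n,R)$ be the maximal integer $k\ge1$ for which $\frac nk\le q\,E\left(z,\left\lfloor\frac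 Rk\right\rfloor\right)$, and $k_z(n,R)=0$ if there is no such integer. Put $k(x,n,R)=\min_{z\in B(x,R)}k_z(n,R)$ (interpreted as $0$ when $R=0$). For nonempty $A,B\subset\Gamma$ let $d=d(A,B)=\min\{d(a,b):a\in A,b\in B\}$, $k(n,A,B)=\min_{z\in A}k(z,n,d)$ and $\kappa(n,A,B)=\max\{k(n,A,B),k(n,B,A)\}$. *)

theory Defs
  imports "HOL-Probability.Probability"
begin

text \<open>The vertex set of the graph is the whole type, and the weights are extended by
  zero off the edges, so that x and y are adjacent iff \<open>w x y > 0\<close>. Loops are not excluded.\<close>

locale weighted_graph =
  fixes w :: "'a \<Rightarrow> 'a \<Rightarrow> real"
  assumes countable_vertices: "countable (UNIV :: 'a set)"
    and infinite_vertices: "infinite (UNIV :: 'a set)"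
    and weight_nonneg: "0 \<le> w x y"
    and weight_sym: "w x y = w y x"
    and locally_finite: "finite {y. 0 < w x y}"
    and connected: "(\<lambda>u v. 0 < w u v)\<^sup>*\<^sup>* x y"
begin

definition adj :: "'a \<Rightarrow> 'a \<Rightarrow> bool" where
  "adj x y \<longleftrightarrow> 0 < w x y"

definition mu :: "'a \<Rightarrow> real" where
  "mu x = (\<Sum>y | adj x y. w x y)"

definition mu_set :: "'a set \<Rightarrow> ennreal" where
  "mu_set A = (\<integral>\<^sup>+ y. ennreal (mu y) \<partial>count_space A)"

definition gdist :: "'a \<Rightarrow> 'a \<Rightarrow> nat" where
  "gdist x y = (LEAST n. (adj ^^ n) x y)"

definition gball :: "'a \<Rightarrow> real \<Rightarrow> 'a set" where
  "gball x R = {y. real (gdist x y) < R}"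

definition trans_prob :: "'a \<Rightarrow> 'a \<Rightarrow> real" where
  "trans_prob x y = w x y / mu x"

text \<open>The law of the next position given the past (a path prefix of length n):
  at time 0 it is the point mass at the starting vertex, later it depends on the last position.\<close>

fun step_kernel :: "'a \<Rightarrow> nat \<Rightarrow> (nat \<Rightarrow> 'a) \<Rightarrow> 'a measure" where
  "step_kernel x 0 \<omega> = return (count_space UNIV) x"
| "step_kernel x (Suc n) \<omega> = density (count_space UNIV) (\<lambda>y. ennreal (trans_prob (\<omega> n) y))"

text \<open>The law of the chain started at x, on the path space \<open>nat \<Rightarrow> 'a\<close>, as provided by the
  Ionescu-Tulcea theorem; the chain itself consists of the coordinates \<open>\<omega> n\<close>.
  See \<open>emeasure_walk_cylinder\<close> below for its finite-dimensional distributions.\<close>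

definition walk :: "'a \<Rightarrow> (nat \<Rightarrow> 'a) measure" where
  "walk x = projective_family.lim UNIV
     (Ionescu_Tulcea.CI (step_kernel x) (\<lambda>_. count_space UNIV)) (\<lambda>_. count_space UNIV)"

definition Pn :: "nat \<Rightarrow> 'a \<Rightarrow> 'a \<Rightarrow> real" where
  "Pn n x y = measure (walk x) {\<omega> \<in> space (walk x). \<omega> n = y}"

definition pn :: "nat \<Rightarrow> 'a \<Rightarrow> 'a \<Rightarrow> real" where
  "pn n x y = Pn n x y / mu y"

definition exit_time :: "'a set \<Rightarrow> (nat \<Rightarrow> 'a) \<Rightarrow> enat" where
  "exit_time A \<omega> = (INF k \<in> {k. \<omega> k \<notin> A}. enat k)"

definition mean_exit :: "'a \<Rightarrow> 'a set \<Rightarrow> ennreal" where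
  "mean_exit x A = (\<integral>\<^sup>+ \<omega>. ennreal_of_enat (exit_time A \<omega>) \<partial>walk x)"

definition E :: "'a \<Rightarrow> real \<Rightarrow> ennreal" where
  "E x R = mean_exit x (gball x R)"

text \<open>For finite nonempty A, in particular for balls of positive radius, the supremum is a maximum.\<close>

definition max_mean_exit :: "'a set \<Rightarrow> ennreal" where
  "max_mean_exit A = (SUP x\<in>A. mean_exit x A)"

definition Ebar :: "'a \<Rightarrow> real \<Rightarrow> ennreal" where
  "Ebar x R = max_mean_exit (gball x R)"

definition cond_Ebar :: bool where
  "cond_Ebar \<longleftrightarrow> (\<exists>C::real. C > 0 \<and> (\<forall>x. \<forall>R>0. Ebar x R \<le> ennreal C * E x R))"

definition kernel_ok :: "real \<Rightarrow> 'a \<Rightarrow> nat \<Rightarrow> real \<Rightarrow> nat \<Rightarrow> bool" where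
  "kernel_ok q z n R k \<longleftrightarrow>
     1 \<le> k \<and> ennreal (real n / real k) \<le> ennreal q * E z (of_int \<lfloor>R / real k\<rfloor>)"

text \<open>For \<open>n \<ge> 1\<close> the admissible k are bounded by R, because \<open>E z 0 = 0\<close>.\<close>

definition k_point :: "real \<Rightarrow> 'a \<Rightarrow> nat \<Rightarrow> real \<Rightarrow> nat" where
  "k_point q z n R = (if \<exists>k. kernel_ok q z n R k then GREATEST k. kernel_ok q z n R k else 0)"

definition k_ball :: "real \<Rightarrow> 'a \<Rightarrow> nat \<Rightarrow> real \<Rightarrow> nat" where
  "k_ball q x n R = (if R = 0 then 0 else INF z\<in>gball x R. k_point q z n R)"

definition set_dist :: "'a set \<Rightarrow> 'a set \<Rightarrow> nat" where
  "set_dist A B = (INF (a, b)\<in>A \<times> B. gdist a b)"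

definition k_sets :: "real \<Rightarrow> nat \<Rightarrow> 'a set \<Rightarrow> 'a set \<Rightarrow> nat" where
  "k_sets q n A B = (INF z\<in>A. k_ball q z n (real (set_dist A B)))"

definition kappa :: "real \<Rightarrow> nat \<Rightarrow> 'a set \<Rightarrow> 'a set \<Rightarrow> nat" where
  "kappa q n A B = max (k_sets q n A B) (k_sets q n B A)"

lemma ex_neighbour: "\<exists>y. 0 < w x y"
proof -
  obtain z where "z \<noteq> x" using infinite_vertices
    by (metis UNIV_eq_I finite.emptyI finite.insertI singletonI)
  with connected[of x z] show ?thesis
    by (metis converse_rtranclpE)
qed

lemma mu_pos: "0 < mu x"
  unfolding mu_def adj_def using ex_neighbour[of x] locally_finite[of x]
  by (intro sum_pos) auto

lemma trans_prob_nonneg: "0 \<le> trans_prob x y"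
  unfolding trans_prob_def using mu_pos[of x] weight_nonneg[of x y] by simp

lemma weight_zero: "\<not> adj x y \<Longrightarrow> w x y = 0"
  using weight_nonneg[of x y] by (simp add: adj_def)

lemma nn_integral_trans_prob: "(\<integral>\<^sup>+ y. ennreal (trans_prob x y) \<partial>count_space UNIV) = 1"
proof -
  have "(\<integral>\<^sup>+ y. ennreal (trans_prob x y) \<partial>count_space UNIV)
      = (\<Sum>y | adj x y. ennreal (trans_prob x y))"
    using locally_finite[of x, folded adj_def] weight_zero[of x]
    by (intro nn_integral_count_space') (auto simp: trans_prob_def)
  also have "\<dots> = ennreal (\<Sum>y | adj x y. trans_prob x y)"
    by (simp add: trans_prob_nonneg)
  also have "(\<Sum>y | adj x y. trans_prob x y) = 1"
    using mu_pos[of x] by (simp add: trans_prob_def sum_divide_distrib[symmetric] mu_def[symmetric])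
  finally show ?thesis by simp
qed

lemma prob_space_step: "prob_space (step_kernel x n \<omega>)"
proof (cases n)
  case 0
  then show ?thesis by (simp add: prob_space_return)
next
  case (Suc m)
  then show ?thesis
    by (auto intro!: prob_spaceI simp: emeasure_density nn_integral_trans_prob)
qed

lemma sets_step [simp]: "sets (step_kernel x n \<omega>) = UNIV"
  by (cases n) simp_all

lemma step_kernel_Suc:
  "step_kernel x (Suc n) = (\<lambda>\<omega>. density (count_space UNIV) (\<lambda>y. ennreal (trans_prob (\<omega> n) y)))"
  by (simp add: fun_eq_iff)

lemma Ionescu_Tulcea_step: "Ionescu_Tulcea (step_kernel x) (\<lambda>_. count_space UNIV)"
proof (rule Ionescu_Tulcea.intro)
  fix n
  show "step_kernel x n \<in> measurable (PiM {0..<n} (\<lambda>_. count_space UNIV)) (subprob_algebra (count_space UNIV))"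
  proof (cases n)
    case 0
    then show ?thesis
      using prob_space_step[of x 0]
      by (auto intro!: measurable_const simp: space_subprob_algebra fun_eq_iff prob_space_imp_subprob_space
        cong: measurable_cong)
  next
    case (Suc m)
    have *: "(\<lambda>v. density (count_space UNIV) (\<lambda>y. ennreal (trans_prob v y)))
        \<in> measurable (count_space UNIV) (subprob_algebra (count_space UNIV))"
      using prob_space_step[of x "Suc m" "\<lambda>_. _"]
      by (auto simp: space_subprob_algebra prob_space_imp_subprob_space)
    have "(\<lambda>\<omega>. \<omega> m) \<in> measurable (PiM {0..<n} (\<lambda>_. count_space UNIV)) (count_space UNIV)"
      using Suc by (intro measurable_component_singleton) auto
    from measurable_compose[OF this *] show ?thesis
      by (simp only: Suc step_kernel_Suc)
  qed
qed (rule prob_space_step)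

lemma sets_walk: "sets (walk x) = sets (PiM UNIV (\<lambda>_. count_space UNIV))"
proof -
  interpret IT: Ionescu_Tulcea "step_kernel x" "\<lambda>_. count_space UNIV" by (rule Ionescu_Tulcea_step)
  show ?thesis by (simp add: walk_def IT.PF.sets_lim)
qed

lemma space_walk: "space (walk x) = UNIV"
  using sets_eq_imp_space_eq[OF sets_walk[of x]] by (simp add: space_PiM)

lemma emeasure_walk_cylinder:
  "emeasure (walk x) {\<omega>. \<forall>i\<le>n. \<omega> i = f i}
     = (if f 0 = x then ennreal (\<Prod>i<n. trans_prob (f i) (f (Suc i))) else 0)"
proof -
  interpret IT: Ionescu_Tulcea "step_kernel x" "\<lambda>_. count_space UNIV" by (rule Ionescu_Tulcea_step)
  let ?M = "\<lambda>_::nat. count_space (UNIV :: 'a set)"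
  let ?S = "\<lambda>n. PiE {0..<n} (\<lambda>i. {f i})"
  have S: "?S n \<in> sets (PiM {0..<n} ?M)" for n by (intro sets_PiM_I_finite) auto
  have C: "emeasure (IT.C 0 (Suc n) (\<lambda>_. undefined)) (?S (Suc n))
      = (if f 0 = x then ennreal (\<Prod>i<n. trans_prob (f i) (f (Suc i))) else 0)" for n
  proof -
    have step: "emeasure (IT.C 0 (Suc n) (\<lambda>_. undefined)) (?S (Suc n))
        = (\<integral>\<^sup>+ \<omega>. emeasure (step_kernel x n (restrict f {0..<n})) {f n} * indicator (?S n) \<omega>
            \<partial>IT.C 0 n (\<lambda>_. undefined))" for n
    proof -
      have "emeasure (IT.C 0 (Suc n) (\<lambda>_. undefined)) (?S (Suc n))
        = (\<integral>\<^sup>+ \<omega>. emeasure (IT.eP n \<omega>) (?S (Suc n)) \<partial>IT.C 0 n (\<lambda>_. undefined))"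
        unfolding IT.C.simps add_0
      proof (rule emeasure_bind[where N="PiM {0..<Suc n} ?M"])
        show "space (IT.C 0 n (\<lambda>_. undefined)) \<noteq> {}"
          by (simp add: IT.space_C space_PiM PiE_eq_empty_iff)
        show "IT.eP n \<in> measurable (IT.C 0 n (\<lambda>_. undefined)) (subprob_algebra (PiM {0..<Suc n} ?M))"
        proof -
          have "(\<lambda>_. undefined) \<in> space (PiM {0..<0} ?M)" by (simp add: space_PiM)
          from IT.sets_C[OF this, of n] show ?thesis
            using IT.measurable_eP[of n] measurable_cong_sets by (metis add_0)
        qed
      qed (rule S)
      also have "\<dots> = (\<integral>\<^sup>+ \<omega>. emeasure (step_kernel x n (restrict f {0..<n})) {f n} * indicator (?S n) \<omega>
            \<partial>IT.C 0 n (\<lambda>_. undefined))"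
      proof (intro nn_integral_cong)
        fix \<omega> assume "\<omega> \<in> space (IT.C 0 n (\<lambda>_. undefined))"
        then have \<omega>: "\<omega> \<in> space (PiM {0..<n} ?M)" by (simp add: IT.space_C space_PiM)
        then have ext: "\<omega> \<in> extensional {0..<n}" by (simp add: space_PiM PiE_def)
        have "{a. fun_upd \<omega> n a \<in> ?S (Suc n)} = (if \<omega> \<in> ?S n then {f n} else {})"
          using ext by (auto simp: PiE_iff extensional_def less_Suc_eq split: if_splits)
        moreover have "\<omega> = restrict f {0..<n}" if "\<omega> \<in> ?S n"
          using that by (auto simp: PiE_iff extensional_def fun_eq_iff)
        ultimately show "emeasure (IT.eP n \<omega>) (?S (Suc n))
          = emeasure (step_kernel x n (restrict f {0..<n})) {f n} * indicator (?S n) \<omega>"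
          using IT.emeasure_eP[OF \<omega> S[of "Suc n"]] by (auto simp: vimage_def)
      qed
      finally show ?thesis .
    qed
    have step': "emeasure (IT.C 0 (Suc n) (\<lambda>_. undefined)) (?S (Suc n))
        = emeasure (step_kernel x n (restrict f {0..<n})) {f n}
          * emeasure (IT.C 0 n (\<lambda>_. undefined)) (?S n)" for n
      unfolding step using S[of n] IT.sets_C[of "\<lambda>_. undefined" 0 n]
      by (subst nn_integral_cmult_indicator) (auto simp: space_PiM)
    show ?thesis
    proof (induction n)
      case 0
      have "emeasure (IT.C 0 0 (\<lambda>_. undefined)) (?S 0) = 1"
        using S[of 0] by (simp add: PiM_empty)
      then show ?case by (subst step') (auto simp: indicator_def)
    next
      case (Suc n)
      have "emeasure (step_kernel x (Suc n) (restrict f {0..<Suc n})) {f (Suc n)}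
          = ennreal (trans_prob (f n) (f (Suc n)))"
        by (simp add: emeasure_density nn_integral_count_space_indicator[symmetric])
      with Suc.IH show ?case
        by (subst step') (simp add: ennreal_mult' trans_prob_nonneg prod_nonneg mult.commute del: IT.C.simps)
    qed
  qed
  have eq: "{\<omega>. \<forall>i\<le>n. \<omega> i = f i} = IT.PF.emb UNIV {0..<Suc n} (?S (Suc n))"
    by (auto simp: prod_emb_def space_PiM PiE_iff less_Suc_eq_le)
  show ?thesis
    unfolding eq walk_def C[symmetric]
    using S[of "Suc n"] by (subst IT.lim, simp, simp, subst IT.emeasure_CI[of _ "Suc n"]) (auto simp: prod_emb_id)
qed

end

definition ennreal_sqrt :: "ennreal \<Rightarrow> ennreal" where
  "ennreal_sqrt a = (if a = \<infinity> then \<infinity> else ennreal (sqrt (enn2real a)))"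

end

theory Submission
  imports Defs
begin

text \<open>Write \<open>P\<close> for the transition operator and \<open>a = 1 / (2 C)\<close>, and let \<open>K\<close> be the minimum of
  \<open>k\<^sub>z = k\<^sub>z(n, R)\<close> over \<open>z\<close> in \<open>B(x, R)\<close>. By the condition on the mean exit times the walk from such a \<open>z\<close>,
  discounted at rate \<open>q K / n\<close>, gains a factor \<open>exp (- a K / k\<^sub>z)\<close> before it leaves the ball about \<open>z\<close>
  of radius \<open>R / k\<^sub>z\<close>. The gain per unit of distance is thus at least \<open>a K / R\<close> wherever the walk
  is, although \<open>k\<^sub>z\<close> may be much larger than \<open>K\<close>. Adding the excursions up, the set \<open>B\<close> at distance
  \<open>R\<close> from \<open>x\<close> is reached at time \<open>n\<close> with probability at most \<open>exp (q K - a (K - 1))\<close>.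
  Summing over \<open>x\<close> in \<open>A\<close>, using the symmetry of the kernel and taking the geometric mean with the
  trivial bound by \<open>\<mu>(B)\<close> gives the theorem for \<open>K \<ge> 2\<close>.

  For \<open>K = 1\<close> the bound \<open>exp q\<close> is void. If \<open>d(A, B) \<ge> 2\<close>, the sum is nevertheless at most half of
  \<open>(\<mu>(A) \<mu>(B))\<^sup>1\<^sup>/\<^sup>2\<close> for every \<open>n\<close>, by splitting \<open>P\<^sup>n\<close> into two halves; if \<open>d(A, B) = 1\<close>, a single
  excursion, from the ball of radius one about \<open>x\<close>, suffices.\<close>

context weighted_graph
begin

subsection \<open>Killed transition operators\<close>

lemma adj_sym: "adj x y \<longleftrightarrow> adj y x"
  by (simp add: adj_def weight_sym[of x y])

lemma finite_adj [simp]: "finite {y. adj x y}"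
  using locally_finite[of x] by (simp add: adj_def)

lemma sum_trans_prob: "(\<Sum>y | adj x y. trans_prob x y) = 1"
  using mu_pos[of x] by (simp add: trans_prob_def sum_divide_distrib[symmetric] mu_def[symmetric])

text \<open>The transition operator of the chain killed on leaving \<open>A\<close>; \<open>A = UNIV\<close> gives the
  transition operator itself.\<close>

definition kop :: "'a set \<Rightarrow> ('a \<Rightarrow> real) \<Rightarrow> 'a \<Rightarrow> real" where
  "kop A f x = indicator A x * (\<Sum>y | adj x y. trans_prob x y * f y)"

lemma kop_cong: "(\<And>y. adj x y \<Longrightarrow> f y = g y) \<Longrightarrow> kop A f x = kop A g x"
  by (simp add: kop_def)

lemma kop_mono: "(\<And>y. adj x y \<Longrightarrow> f y \<le> g y) \<Longrightarrow> kop A f x \<le> kop A g x"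
  unfolding kop_def by (intro mult_left_mono sum_mono) (auto simp: trans_prob_nonneg)

lemma kop_add: "kop A (\<lambda>y. f y + g y) x = kop A f x + kop A g x"
  by (simp add: kop_def distrib_left sum.distrib)

lemma kop_diff: "kop A (\<lambda>y. f y - g y) x = kop A f x - kop A g x"
  by (simp add: kop_def right_diff_distrib sum_subtractf)

lemma kop_cmult: "kop A (\<lambda>y. c * f y) x = c * kop A f x"
  unfolding kop_def sum_distrib_left by (simp add: mult_ac)

lemma kop_sum: "kop A (\<lambda>y. \<Sum>i\<in>I. f i y) x = (\<Sum>i\<in>I. kop A (f i) x)"
  unfolding kop_def sum_distrib_left by (rule sum.swap)

lemma kop_const: "kop A (\<lambda>_. c) x = indicator A x * c"
  by (simp add: kop_def sum_distrib_right[symmetric] sum_trans_prob)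

lemma kop_UNIV: "x \<in> A \<Longrightarrow> kop A f x = kop UNIV f x"
  by (simp add: kop_def)

lemma kop_notin: "x \<notin> A \<Longrightarrow> kop A f x = 0"
  by (simp add: kop_def)

lemma kop_nonneg: "(\<And>y. adj x y \<Longrightarrow> 0 \<le> f y) \<Longrightarrow> 0 \<le> kop A f x"
  using kop_mono[of x "\<lambda>_. 0" f A] by (simp add: kop_const)

lemma kop_pow_nonneg: "(\<And>y. 0 \<le> f y) \<Longrightarrow> 0 \<le> (kop A ^^ n) f x"
  by (induction n arbitrary: x) (auto intro: kop_nonneg)

lemma kop_pow_mono: "(\<And>y. f y \<le> g y) \<Longrightarrow> (kop A ^^ n) f x \<le> (kop A ^^ n) g x"
  by (induction n arbitrary: x) (auto intro: kop_mono)

lemma kop_pow_cmult: "(kop A ^^ n) (\<lambda>y. c * f y) x = c * (kop A ^^ n) f x"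
  by (induction n arbitrary: x) (auto simp: kop_cmult[symmetric] intro!: kop_cong)

lemma kop_pow_add: "(kop A ^^ n) (\<lambda>y. f y + g y) x = (kop A ^^ n) f x + (kop A ^^ n) g x"
  by (induction n arbitrary: x) (auto simp: kop_add[symmetric] intro!: kop_cong)

lemma kop_pow_sum: "(kop A ^^ n) (\<lambda>y. \<Sum>i\<in>I. f i y) x = (\<Sum>i\<in>I. (kop A ^^ n) (f i) x)"
  by (induction n arbitrary: x) (auto simp: kop_sum[symmetric] intro!: kop_cong)

lemma kop_pow_const: "(kop UNIV ^^ n) (\<lambda>_. c) = (\<lambda>_. c)"
proof (induction n)
  case (Suc n)
  then show ?case by (simp add: kop_const[abs_def])
qed simp

section \<open>The law of the walk in terms of iterated operators\<close>

lemma walk_events [measurable]: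
  "Measurable.pred (walk x) (\<lambda>\<omega>. \<omega> n \<in> A)"
proof -
  have "(\<lambda>\<omega>. \<omega> n) \<in> measurable (PiM UNIV (\<lambda>_. count_space UNIV)) (count_space UNIV)"
    by (rule measurable_component_singleton) simp
  then have "(\<lambda>\<omega>. \<omega> n) \<in> measurable (walk x) (count_space UNIV)"
    using measurable_cong_sets[OF sets_walk[of x] refl] by blast
  then show ?thesis
    by (rule measurable_compose) simp
qed

lemma walk_eq_event [measurable]: "Measurable.pred (walk x) (\<lambda>\<omega>. \<omega> n = y)"
  using walk_events[where A = "{y}"] by simp

lemma walk_sets: "Measurable.pred (walk x) P \<Longrightarrow> {\<omega>. P \<omega>} \<in> sets (walk x)"
  by (simp add: pred_def space_walk)

text \<open>The Markov property: the event splits into countably many cylinders, and prolonging each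
  of them by the step from \<open>v\<close> to \<open>y\<close> multiplies its mass by the same
  factor.\<close>

lemma emeasure_walk_step:
  "emeasure (walk x) {\<omega>. (\<forall>i\<le>n. \<omega> i \<in> A) \<and> \<omega> n = v \<and> \<omega> (Suc n) = y}
    = emeasure (walk x) {\<omega>. (\<forall>i\<le>n. \<omega> i \<in> A) \<and> \<omega> n = v} * ennreal (trans_prob v y)"
proof -
  \<comment> \<open>Prefixes are taken extensional, so that each path of the event lies in exactly
    one cylinder \<open>X f\<close>.\<close>
  define I where "I = {f \<in> PiE {..n} (\<lambda>_. A). f n = v}"
  define X where "X f = {\<omega> :: nat \<Rightarrow> 'a. \<forall>i\<le>n. \<omega> i = f i}" for f
  define Y where "Y f = {\<omega> :: nat \<Rightarrow> 'a. \<forall>i\<le>Suc n. \<omega> i = (f(Suc n := y)) i}" for f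
  have I: "countable I"
  proof -
    have "countable (PiE {..n} (\<lambda>_. A))"
      using countable_vertices by (intro countable_PiE) (auto intro: countable_subset)
    then show ?thesis unfolding I_def by (rule countable_subset[rotated]) auto
  qed
  have restr: "\<exists>f\<in>I. \<forall>i\<le>n. \<omega> i = f i" if "\<forall>i\<le>n. \<omega> i \<in> A" "\<omega> n = v" for \<omega>
    using that by (intro bexI[of _ "restrict \<omega> {..n}"]) (auto simp: I_def)
  have Yiff: "\<omega> \<in> Y f \<longleftrightarrow> \<omega> \<in> X f \<and> \<omega> (Suc n) = y" for \<omega> f
    by (auto simp: X_def Y_def le_Suc_eq)
  have SX: "{\<omega>. (\<forall>i\<le>n. \<omega> i \<in> A) \<and> \<omega> n = v} = \<Union>(X ` I)"
    using restr by (force simp: I_def X_def PiE_iff)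
  have SY: "{\<omega>. (\<forall>i\<le>n. \<omega> i \<in> A) \<and> \<omega> n = v \<and> \<omega> (Suc n) = y} = \<Union>(Y ` I)"
    using SX unfolding set_eq_iff UN_iff Yiff by blast
  have dX: "disjoint_family_on X I"
  proof -
    have "f = g" if "f \<in> I" "g \<in> I" "\<omega> \<in> X f" "\<omega> \<in> X g" for f g \<omega>
      using that by (intro PiE_ext[of f "{..n}" "\<lambda>_. A" g]) (auto simp: I_def X_def)
    then show ?thesis by (auto simp: disjoint_family_on_def)
  qed
  then have dY: "disjoint_family_on Y I"
    using Yiff by (fastforce simp: disjoint_family_on_def)
  have mX: "X f \<in> sets (walk x)" and mY: "Y f \<in> sets (walk x)" for f
    unfolding X_def Y_def by (intro walk_sets; measurable)+
  have "emeasure (walk x) (Y f) = emeasure (walk x) (X f) * ennreal (trans_prob v y)" if "f \<in> I" for f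
  proof -
    have "f n = v" using that by (simp add: I_def)
    moreover have "(\<Prod>i<n. trans_prob ((f(Suc n := y)) i) ((f(Suc n := y)) (Suc i)))
        = (\<Prod>i<n. trans_prob (f i) (f (Suc i)))"
      by (intro prod.cong) auto
    ultimately show ?thesis
      unfolding X_def Y_def emeasure_walk_cylinder
      by (simp add: ennreal_mult prod_nonneg trans_prob_nonneg)
  qed
  then have "(\<integral>\<^sup>+f. emeasure (walk x) (Y f) \<partial>count_space I)
      = (\<integral>\<^sup>+f. emeasure (walk x) (X f) * ennreal (trans_prob v y) \<partial>count_space I)"
    by (intro nn_integral_cong) auto
  then show ?thesis
    unfolding SX SY
    by (simp add: emeasure_UN_countable[OF mX I dX] emeasure_UN_countable[OF mY I dY]
        nn_integral_multc)
qed

text \<open>The induction splits off the last step of the walk, whereas \<open>kop A\<close> acts on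
  the first; linearity moves the last step inside the iterate, and \<open>funpow_swap1\<close>
  restores the order.\<close>

lemma emeasure_walk_killed:
  "emeasure (walk x) {\<omega>. (\<forall>i\<le>n. \<omega> i \<in> A) \<and> \<omega> n = y}
    = ennreal ((kop A ^^ n) (indicator (A \<inter> {y})) x)"
proof (induction n arbitrary: y)
  case 0
  have *: "{\<omega> :: nat \<Rightarrow> 'a. (\<forall>i\<le>0. \<omega> i \<in> A) \<and> \<omega> 0 = y}
      = (if y \<in> A then {\<omega>. \<forall>i\<le>0. \<omega> i = y} else {})"
    by auto
  have "emeasure (walk x) {\<omega>. \<forall>i\<le>0. \<omega> i = y} = (if y = x then 1 else 0)"
    using emeasure_walk_cylinder[of x 0 "\<lambda>_. y"] by simp
  then show ?case
    unfolding * by (auto simp: indicator_def)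
next
  case (Suc n)
  define S where "S v = {\<omega> :: nat \<Rightarrow> 'a. (\<forall>i\<le>n. \<omega> i \<in> A) \<and> \<omega> n = v}" for v
  define T where "T v = {\<omega> :: nat \<Rightarrow> 'a. (\<forall>i\<le>n. \<omega> i \<in> A) \<and> \<omega> n = v \<and> \<omega> (Suc n) = y}" for v
  let ?F = "\<lambda>v. (kop A ^^ n) (indicator (A \<inter> {v})) x"
  show ?case
  proof (cases "y \<in> A")
    case True
    have "emeasure (walk x) {\<omega>. (\<forall>i\<le>Suc n. \<omega> i \<in> A) \<and> \<omega> (Suc n) = y}
        = emeasure (walk x) (\<Union>(range T))"
      using True by (intro arg_cong2[of _ _ _ _ emeasure]) (auto simp: T_def le_Suc_eq)
    also have "\<dots> = (\<integral>\<^sup>+v. emeasure (walk x) (T v) \<partial>count_space UNIV)"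
    proof (rule emeasure_UN_countable)
      show "T v \<in> sets (walk x)" for v
        unfolding T_def by (intro walk_sets) measurable
      show "disjoint_family_on T UNIV"
        by (auto simp: disjoint_family_on_def T_def)
    qed (rule countable_vertices)
    also have "\<dots> = (\<integral>\<^sup>+v. ennreal (?F v) * ennreal (trans_prob v y) \<partial>count_space UNIV)"
      unfolding T_def emeasure_walk_step Suc.IH ..
    also have "\<dots> = (\<Sum>v | adj y v. ennreal (?F v) * ennreal (trans_prob v y))"
      by (intro nn_integral_count_space' finite_adj)
        (auto simp: trans_prob_def adj_sym[of y] weight_zero)
    also have "\<dots> = (\<Sum>v | adj y v. ennreal (?F v * trans_prob v y))"
      by (intro sum.cong refl ennreal_mult[symmetric] trans_prob_nonneg kop_pow_nonneg) simp
    also have "\<dots> = ennreal (\<Sum>v | adj y v. ?F v * trans_prob v y)"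
      by (intro sum_ennreal mult_nonneg_nonneg trans_prob_nonneg kop_pow_nonneg) simp
    also have "(\<Sum>v | adj y v. ?F v * trans_prob v y)
        = (kop A ^^ n) (\<lambda>u. \<Sum>v | adj y v. trans_prob v y * indicator (A \<inter> {v}) u) x"
      by (simp only: kop_pow_sum kop_pow_cmult mult.commute)
    also have "(\<lambda>u. \<Sum>v | adj y v. trans_prob v y * indicator (A \<inter> {v}) u)
        = kop A (indicator (A \<inter> {y}))"
    proof
      fix u
      have "(\<Sum>v | adj y v. trans_prob v y * indicator (A \<inter> {v}) u)
          = (\<Sum>v | adj y v. if v = u then indicator A u * trans_prob u y else 0)"
        by (intro sum.cong) (auto simp: indicator_def)
      moreover have "kop A (indicator (A \<inter> {y})) u
          = indicator A u * (\<Sum>v | adj u v. if v = y then trans_prob u y else 0)"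
        unfolding kop_def using True
        by (intro arg_cong2[of _ _ _ _ "(*)"] sum.cong) (auto simp: indicator_def)
      ultimately show "(\<Sum>v | adj y v. trans_prob v y * indicator (A \<inter> {v}) u)
          = kop A (indicator (A \<inter> {y})) u"
        by (simp add: adj_sym[of y u] trans_prob_def)
    qed
    finally show ?thesis by (simp add: funpow_swap1)
  next
    case False
    then have *: "{\<omega> :: nat \<Rightarrow> 'a. (\<forall>i\<le>Suc n. \<omega> i \<in> A) \<and> \<omega> (Suc n) = y} = {}" by auto
    have "(kop A ^^ Suc n) (\<lambda>_. 0) x = 0"
      using kop_pow_cmult[where c = 0 and n = "Suc n" and f = "\<lambda>_. 0"] by simp
    with False show ?thesis unfolding * by (simp add: indicator_def[abs_def])
  qed
qed

lemma Pn_eq_kop: "Pn n x y = (kop UNIV ^^ n) (indicator {y}) x"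
  using emeasure_walk_killed[of x n UNIV y]
  by (simp add: Pn_def space_walk measure_def kop_pow_nonneg)

lemma sum_Pn_eq_kop: "finite B \<Longrightarrow> (\<Sum>y\<in>B. Pn n x y) = (kop UNIV ^^ n) (indicator B) x"
proof -
  assume B: "finite B"
  have "(indicator B :: 'a \<Rightarrow> real) = (\<lambda>u. \<Sum>y\<in>B. indicator {y} u)"
    using B by (auto simp: fun_eq_iff indicator_def sum.If_cases)
  then show ?thesis by (simp add: Pn_eq_kop kop_pow_sum)
qed

lemma emeasure_walk_stay:
  assumes "finite A"
  shows "emeasure (walk x) {\<omega>. \<forall>i\<le>n. \<omega> i \<in> A} = ennreal ((kop A ^^ n) (indicator A) x)"
proof -
  let ?S = "\<lambda>y. {\<omega> :: nat \<Rightarrow> 'a. (\<forall>i\<le>n. \<omega> i \<in> A) \<and> \<omega> n = y}"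
  have "{\<omega> :: nat \<Rightarrow> 'a. \<forall>i\<le>n. \<omega> i \<in> A} = \<Union>(?S ` A)" by auto
  moreover have "(\<Sum>y\<in>A. emeasure (walk x) (?S y)) = emeasure (walk x) (\<Union>(?S ` A))"
    using assms
    by (intro sum_emeasure)
      (auto simp: disjoint_family_on_def intro!: walk_sets pred_intros_logic pred_intros_countable walk_events walk_eq_event)
  moreover have "(\<Sum>y\<in>A. (kop A ^^ n) (indicator (A \<inter> {y})) x) = (kop A ^^ n) (indicator A) x"
  proof -
    have "(indicator A :: 'a \<Rightarrow> real) = (\<lambda>u. \<Sum>y\<in>A. indicator (A \<inter> {y}) u)"
      using assms by (auto simp: fun_eq_iff indicator_def)
    then show ?thesis by (simp add: kop_pow_sum)
  qed
  ultimately show ?thesis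
    by (simp add: emeasure_walk_killed kop_pow_nonneg)
qed

text \<open>Tail formula for the mean of the exit time T: it is the sum of the probabilities of T >
  n, and T > n means that the walk is in \<open>A\<close> up to time \<open>n\<close>.\<close>

lemma mean_exit_eq_suminf:
  assumes "finite A"
  shows "mean_exit x A = (\<Sum>n. ennreal ((kop A ^^ n) (indicator A) x))"
proof -
  have exit: "enat n < exit_time A \<omega> \<longleftrightarrow> (\<forall>i\<le>n. \<omega> i \<in> A)" for n \<omega>
  proof
    assume L: "enat n < exit_time A \<omega>"
    show "\<forall>i\<le>n. \<omega> i \<in> A"
    proof (intro allI impI, rule ccontr)
      fix i assume "i \<le> n" "\<omega> i \<notin> A"
      then have "exit_time A \<omega> \<le> enat i"
        unfolding exit_time_def by (intro INF_lower) auto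
      with L \<open>i \<le> n\<close> show False
        by (meson enat_ord_simps(1) leD order_trans)
    qed
  next
    assume R: "\<forall>i\<le>n. \<omega> i \<in> A"
    have "enat (Suc n) \<le> exit_time A \<omega>"
      unfolding exit_time_def
    proof (rule INF_greatest)
      fix k assume "k \<in> {k. \<omega> k \<notin> A}"
      then show "enat (Suc n) \<le> enat k" using R by (auto simp: not_less_eq_eq[symmetric])
    qed
    then show "enat n < exit_time A \<omega>"
      by (meson enat_ord_simps(2) lessI less_le_trans)
  qed
  have "exit_time A \<in> measurable (walk x) (count_space UNIV)"
  proof (rule measurable_count_space_eq_countable[THEN iffD2])
    show "countable (UNIV :: enat set)" by (rule countableI_type)
    have gt: "Measurable.pred (walk x) (\<lambda>\<omega>. enat n < exit_time A \<omega>)" for n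
      unfolding exit by measurable
    have pt: "Measurable.pred (walk x) (\<lambda>\<omega>. exit_time A \<omega> = t)" for t
    proof (cases t)
      case (enat m)
      have "exit_time A \<omega> = t \<longleftrightarrow> \<not> enat m < exit_time A \<omega> \<and> (\<forall>k<m. enat k < exit_time A \<omega>)" for \<omega>
        unfolding enat by (cases "exit_time A \<omega>") (auto simp: not_less intro: antisym dest: spec leI)
      then show ?thesis using gt by simp
    next
      case infinity
      have "exit_time A \<omega> = t \<longleftrightarrow> (\<forall>k. enat k < exit_time A \<omega>)" for \<omega>
        unfolding infinity by (cases "exit_time A \<omega>") auto
      then show ?thesis using gt by simp
    qed
    show "exit_time A \<in> space (walk x) \<rightarrow> UNIV \<and> (\<forall>a\<in>UNIV. exit_time A -` {a} \<inter> space (walk x) \<in> sets (walk x))"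
      using walk_sets[OF pt] by (auto simp: space_walk vimage_def)
  qed
  then show ?thesis
    unfolding mean_exit_def by (simp add: nn_integral_enat_function space_walk exit emeasure_walk_stay[OF assms])
qed

subsection \<open>Graph distance\<close>

lemma gdist_walk: "(adj ^^ gdist x y) x y"
proof -
  have "adj\<^sup>*\<^sup>* x y" using connected[of x y] by (simp add: adj_def[abs_def])
  then have "\<exists>n. (adj ^^ n) x y" by (simp add: rtranclp_power)
  then show ?thesis unfolding gdist_def by (rule LeastI_ex)
qed

lemma gdist_le: "(adj ^^ n) x y \<Longrightarrow> gdist x y \<le> n"
  unfolding gdist_def by (rule Least_le)

lemma gdist_self [simp]: "gdist x x = 0"
  using gdist_le[of 0 x x] by simp

lemma gdist_eq_0 [simp]: "gdist x y = 0 \<longleftrightarrow> x = y"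
  using gdist_walk[of x y] by auto

lemma gdist_triangle: "gdist x z \<le> gdist x y + gdist y z"
  by (rule gdist_le) (auto simp: relpowp_add intro: gdist_walk)

lemma gdist_adj_le: "adj x y \<Longrightarrow> gdist x y \<le> 1"
  using gdist_le[of 1 x y] by (simp only: relpowp_1)

lemma gdist_commute: "gdist x y = gdist y x"
proof -
  have "(adj ^^ n) y x" if "(adj ^^ n) x y" for n x y
    using that
  proof (induction n arbitrary: y)
    case (Suc n)
    then obtain z where "(adj ^^ n) x z" "adj z y" by auto
    then show ?case using Suc.IH adj_sym relpowp_Suc_I2 by metis
  qed simp
  then show ?thesis
    using gdist_walk[of x y] gdist_walk[of y x] by (intro antisym gdist_le) auto
qed

lemma gdist_adj_step: "adj y v \<Longrightarrow> gdist x v \<le> Suc (gdist x y)"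
  using gdist_triangle[of x v y] gdist_adj_le[of y v] by simp

lemma gdist_closer_neighbour:
  assumes "x \<noteq> y"
  obtains v where "adj x v" "Suc (gdist v y) = gdist x y"
proof -
  obtain n where n: "gdist x y = Suc n"
    using assms by (cases "gdist x y") auto
  then obtain v where v: "adj x v" "(adj ^^ n) v y"
    using gdist_walk[of x y] relpowp_Suc_D2[of n adj x y] by auto
  moreover have "Suc n \<le> Suc (gdist v y)"
    using gdist_triangle[of x y v] gdist_adj_le[OF v(1)] n by simp
  ultimately show thesis
    using that[of v] gdist_le[of n v y] n by simp
qed

lemma finite_gdist_le: "finite {y. gdist x y \<le> n}"
proof (induction n)
  case (Suc n)
  have "{y. gdist x y \<le> Suc n} \<subseteq> insert x (\<Union>v\<in>{v. gdist x v \<le> n}. {y. adj v y})"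
  proof
    fix y assume y: "y \<in> {y. gdist x y \<le> Suc n}"
    show "y \<in> insert x (\<Union>v\<in>{v. gdist x v \<le> n}. {y. adj v y})"
    proof (cases "y = x")
      case False
      then obtain v where "adj y v" "Suc (gdist v x) = gdist y x"
        by (rule gdist_closer_neighbour)
      then show ?thesis using y by (auto simp: gdist_commute[of _ x] adj_sym[of y])
    qed simp
  qed
  then show ?case
    by (rule finite_subset) (use Suc in auto)
qed simp

lemma gball_nat: "gball x (real r) = {y. gdist x y < r}"
  by (simp add: gball_def)

lemma finite_gball [simp]: "finite (gball x (real r))"
  unfolding gball_nat by (rule finite_subset[OF _ finite_gdist_le[of x r]]) auto

text \<open>One step changes the distance by at most one, so a ball of integer radius is left
  exactly through the sphere of that radius. Bounds on this sphere therefore suffice as boundary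
  data in \<open>ball_decay\<close>.\<close>

lemma gball_neighbour:
  "y \<in> gball z (real r) \<Longrightarrow> adj y v \<Longrightarrow> v \<notin> gball z (real r) \<Longrightarrow> gdist z v = r"
  using gdist_adj_step[of y v z] by (simp add: gball_nat)

subsection \<open>Mean exit times\<close>

text \<open>Outside \<open>A\<close> pick a vertex \<open>o\<close>; since the walk approaches \<open>o\<close> with a probability bounded
  below on \<open>A\<close>, the function \<open>K (1 - \<epsilon>\<^bsup>d(\<cdot>, o)\<^esup>)\<close> decreases by at least one in mean
  at every step in \<open>A\<close>, and so it dominates the mean exit time.\<close>

lemma exit_time_supersolution:
  assumes A: "finite A"
  obtains \<phi> K where "\<And>y. 0 \<le> \<phi> y" "\<And>y. \<phi> y \<le> K"
    "\<And>y. y \<in> A \<Longrightarrow> kop UNIV \<phi> y + 1 \<le> \<phi> y"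
proof -
  obtain b where b: "b \<notin> A"
    using A infinite_vertices ex_new_if_finite by blast
  \<comment> \<open>The inserted 1 covers empty \<open>A\<close> and ensures that \<open>p\<close>
    is at most 1.\<close>
  define p where "p = Min (insert 1 ((\<lambda>(x, y). trans_prob x y) ` (SIGMA x:A. {y. adj x y})))"
  define N where "N = Max (insert 0 ((\<lambda>x. gdist x b) ` A))"
  have fin: "finite (insert 1 ((\<lambda>(x, y). trans_prob x y) ` (SIGMA x:A. {y. adj x y})))"
    using A by auto
  have "p \<in> insert 1 ((\<lambda>(x, y). trans_prob x y) ` (SIGMA x:A. {y. adj x y}))"
    unfolding p_def using fin by (intro Min_in) auto
  then have p0: "0 < p"
    using mu_pos by (auto simp: trans_prob_def adj_def)
  have p1: "p \<le> 1" unfolding p_def using fin by (intro Min_le) auto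
  have pt: "p \<le> trans_prob x y" if "x \<in> A" "adj x y" for x y
    unfolding p_def using fin that by (intro Min_le) auto
  have N: "gdist x b \<le> N" if "x \<in> A" for x
    unfolding N_def using that A by (intro Max_ge) auto
  \<comment> \<open>At distance d from \<open>b\<close>, the step towards \<open>b\<close> alone
    contributes at least \<open>p * e ^ (d - 1) = 2 * e ^ d\<close>, so on \<open>A\<close> the mean
    of \<open>e ^ gdist u b\<close> at least doubles; \<open>K\<close> scales this gain to at least
    1.\<close>
  define e where "e = p / 2"
  have e: "0 < e" "e \<le> 1" using p0 p1 by (auto simp: e_def)
  define K where "K = 1 / e ^ N"
  have K: "0 < K" using e by (simp add: K_def)
  define \<phi> where "\<phi> y = K * (1 - e ^ gdist y b)" for y
  have "kop UNIV \<phi> y + 1 \<le> \<phi> y" if y: "y \<in> A" for y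
  proof -
    from y b have "y \<noteq> b" by auto
    then obtain v where v: "adj y v" "Suc (gdist v b) = gdist y b"
      by (rule gdist_closer_neighbour)
    have "2 * e ^ gdist y b = p * e ^ gdist v b"
      unfolding v(2)[symmetric] by (simp add: e_def)
    also have "\<dots> \<le> trans_prob y v * e ^ gdist v b"
      using pt[OF y v(1)] e by (intro mult_right_mono) auto
    also have "\<dots> \<le> (\<Sum>u | adj y u. trans_prob y u * e ^ gdist u b)"
      using v e by (intro member_le_sum) (auto simp: trans_prob_nonneg)
    also have "\<dots> = kop UNIV (\<lambda>u. e ^ gdist u b) y" by (simp add: kop_def)
    finally have 1: "2 * e ^ gdist y b \<le> kop UNIV (\<lambda>u. e ^ gdist u b) y" .
    have "kop UNIV \<phi> y = K * (1 - kop UNIV (\<lambda>u. e ^ gdist u b) y)"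
      unfolding \<phi>_def by (simp add: kop_cmult kop_diff kop_const)
    also have "\<dots> \<le> K * (1 - 2 * e ^ gdist y b)"
      using 1 K by (intro mult_left_mono) auto
    also have "\<dots> = \<phi> y - K * e ^ gdist y b"
      by (simp add: \<phi>_def algebra_simps)
    finally have 2: "kop UNIV \<phi> y \<le> \<phi> y - K * e ^ gdist y b" .
    have "e ^ N \<le> e ^ gdist y b"
      using e N[OF y] by (intro power_decreasing) auto
    then have "1 \<le> K * e ^ gdist y b" using e by (simp add: K_def field_simps)
    with 2 show ?thesis by simp
  qed
  moreover have "0 \<le> \<phi> y" "\<phi> y \<le> K" for y
    using K e by (auto simp: \<phi>_def power_le_one mult_le_cancel_left1)
  ultimately show thesis by (rule that[rotated 2])
qed

text \<open>By induction on the number of terms, the partial sums of the tail series stay below the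
  supersolution, so the series has a real bounded sum \<open>u\<close>. Conditioning on the first
  step shifts the series by one term, whence \<open>u y - 1\<close>.\<close>

lemma mean_exit_bounded:
  assumes A: "finite A"
  obtains u K where "\<And>y. 0 \<le> u y" "\<And>y. u y \<le> K" "\<And>y. mean_exit y A = ennreal (u y)"
    "\<And>y. y \<in> A \<Longrightarrow> kop UNIV u y = u y - 1" "\<And>y. y \<notin> A \<Longrightarrow> u y = 0"
proof -
  obtain \<phi> K where \<phi>: "\<And>y. 0 \<le> \<phi> y" "\<And>y. \<phi> y \<le> K"
    "\<And>y. y \<in> A \<Longrightarrow> kop UNIV \<phi> y + 1 \<le> \<phi> y"
    using exit_time_supersolution[OF A] by blast
  define h where "h n = (kop A ^^ n) (indicator A)" for n
  have h0: "0 \<le> h n y" for n y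
    unfolding h_def by (rule kop_pow_nonneg) simp
  have hSuc: "h (Suc n) y = kop A (h n) y" for n y by (simp add: h_def)
  have hout: "h n y = 0" if "y \<notin> A" for n y
    using that by (cases n) (auto simp: h_def kop_notin)
  have U: "(\<Sum>k<n. h k y) \<le> \<phi> y" for n y
  proof (induction n arbitrary: y)
    case 0 show ?case by (simp add: \<phi>)
  next
    case (Suc n)
    show ?case
    proof (cases "y \<in> A")
      case True
      have "(\<Sum>k<Suc n. h k y) = h 0 y + kop A (\<lambda>y. \<Sum>k<n. h k y) y"
        unfolding sum.lessThan_Suc_shift by (simp add: hSuc kop_sum)
      also have "\<dots> \<le> 1 + kop A \<phi> y"
        using True by (intro add_mono kop_mono Suc) (simp add: h_def)
      also have "\<dots> \<le> \<phi> y" using \<phi>(3)[OF True] kop_UNIV[OF True] by simp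
      finally show ?thesis .
    qed (simp add: hout \<phi>)
  qed
  have summ: "summable (\<lambda>k. h k y)" for y
    using summableI_nonneg_bounded[OF h0 U] .
  define u where "u y = (\<Sum>k. h k y)" for y
  have u0: "0 \<le> u y" for y unfolding u_def by (intro suminf_nonneg summ h0)
  have uK: "u y \<le> K" for y
    unfolding u_def using \<phi>(2)[of y] U[of y] by (intro suminf_le_const summ) (meson order_trans)
  have "mean_exit y A = ennreal (u y)" for y
    using mean_exit_eq_suminf[OF A, of y] suminf_ennreal2[OF h0 summ, of y] by (simp add: h_def u_def)
  moreover have "kop UNIV u y = u y - 1" if "y \<in> A" for y
  proof -
    have "kop UNIV u y = (\<Sum>v | adj y v. trans_prob y v * (\<Sum>k. h k v))"
      by (simp add: kop_def u_def)
    also have "\<dots> = (\<Sum>v | adj y v. \<Sum>k. trans_prob y v * h k v)"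
      by (simp add: suminf_mult summ)
    also have "\<dots> = (\<Sum>k. \<Sum>v | adj y v. trans_prob y v * h k v)"
      by (intro suminf_sum[symmetric] summable_mult summ)
    also have "\<dots> = (\<Sum>k. h (Suc k) y)"
      using that by (simp add: hSuc kop_def)
    also have "\<dots> = u y - h 0 y"
      unfolding u_def by (rule suminf_split_head[OF summ])
    finally show ?thesis using that by (simp add: h_def)
  qed
  moreover have "u y = 0" if "y \<notin> A" for y using that by (simp add: u_def hout)
  ultimately show thesis using u0 uK by (intro that[of u K])
qed

text \<open>With \<open>u\<close> the mean exit time from the ball and \<open>M\<close> its maximum, \<open>v = 1 - \<theta> u / M\<close> with
  \<open>\<theta> = \<eta> / 2\<close> satisfies \<open>P v \<le> (1 + s) v\<close> in the ball and is at most \<open>exp (- \<eta> / (2 C))\<close> at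
  the centre; it is compared with \<open>U\<close>.\<close>

lemma ball_decay:
  assumes C: "0 < C" "\<And>z. Ebar z (real r) \<le> ennreal C * E z (real r)"
    and r: "1 \<le> r"
    and s: "0 \<le> s" and \<eta>: "0 \<le> \<eta>" "\<eta> \<le> 1" "ennreal \<eta> \<le> ennreal s * E z (real r)"
    and G: "0 \<le> G"
    and U: "\<And>j y. U (Suc j) y = kop UNIV (U j) y"
    and U0: "\<And>y. y \<in> gball z (real r) \<Longrightarrow> U 0 y \<le> 0"
    and bd: "\<And>j y. j < m \<Longrightarrow> gdist z y = r \<Longrightarrow> U j y \<le> (1 + s) ^ j * G"
  shows "U m z \<le> (1 + s) ^ m * (G * exp (- \<eta> / (2 * C)))"
proof -
  let ?A = "gball z (real r)"
  have zA: "z \<in> ?A" using r by (simp add: gball_nat)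
  obtain u K where u: "\<And>y. 0 \<le> u y" "\<And>y. u y \<le> K" "\<And>y. mean_exit y ?A = ennreal (u y)"
    "\<And>y. y \<in> ?A \<Longrightarrow> kop UNIV u y = u y - 1" "\<And>y. y \<notin> ?A \<Longrightarrow> u y = 0"
    by (rule mean_exit_bounded[OF finite_gball[of z r]]) (rule that)
  define M where "M = Max (u ` ?A)"
  have uM: "u y \<le> M" if "y \<in> ?A" for y
    unfolding M_def using that by (intro Max_ge) auto
  have "M \<in> u ` ?A" unfolding M_def using zA by (intro Max_in) auto
  then obtain y0 where y0: "y0 \<in> ?A" "M = u y0" by auto
  have u1: "1 \<le> u y" if "y \<in> ?A" for y
    using u(4)[OF that] kop_nonneg[of y u UNIV] u(1) by simp
  have M1: "1 \<le> M" using u1[OF zA] uM[OF zA] by simp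
  \<comment> \<open>The condition on the mean exit times enters here: the maximum \<open>M\<close>
    is at most \<open>C\<close> times the value at the centre.\<close>
  have "ennreal M \<le> ennreal C * E z (real r)"
  proof -
    have "ennreal M = mean_exit y0 ?A" using u(3) y0 by simp
    also have "\<dots> \<le> Ebar z (real r)"
      unfolding Ebar_def max_mean_exit_def using y0 by (intro SUP_upper)
    finally show ?thesis using C(2)[of z] by (rule order_trans)
  qed
  then have MC: "M \<le> C * u z"
    using C(1) u(1)[of z] by (simp add: E_def u(3) ennreal_mult'[symmetric])
  have "\<eta> \<le> s * u z"
    using \<eta>(3) s u(1)[of z] by (simp add: E_def u(3) ennreal_mult'[symmetric])
  also have "\<dots> \<le> s * M" using uM[OF zA] s by (rule mult_left_mono)
  finally have sM: "\<eta> \<le> s * M" .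
  \<comment> \<open>Halving \<open>\<eta>\<close> keeps \<open>v\<close> at least 1/2 in the ball,
    so that the increment \<open>\<theta> / M\<close> of \<open>v\<close> is absorbed by the factor
    \<open>1 + s\<close>.\<close>
  define \<theta> where "\<theta> = \<eta> / 2"
  have \<theta>: "0 \<le> \<theta>" "\<theta> \<le> 1 / 2" using \<eta> by (auto simp: \<theta>_def)
  define v where "v y = 1 - \<theta> / M * u y" for y
  have v_half: "1 / 2 \<le> v y" if "y \<in> ?A" for y
  proof -
    have "\<theta> / M * u y \<le> \<theta> / M * M" using uM[OF that] \<theta> M1 by (intro mult_left_mono) auto
    also have "\<dots> \<le> 1 / 2" using \<theta> M1 by simp
    finally show ?thesis unfolding v_def by linarith
  qed
  have Pv: "kop UNIV v y \<le> (1 + s) * v y" if "y \<in> ?A" for y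
  proof -
    have "kop UNIV v y = 1 - \<theta> / M * kop UNIV u y"
      unfolding v_def by (simp only: kop_diff kop_const kop_cmult) simp
    also have "\<dots> = v y + \<theta> / M"
      by (simp add: v_def u(4)[OF that] right_diff_distrib diff_divide_distrib)
    finally have "kop UNIV v y = v y + \<theta> / M" .
    also have "\<theta> / M \<le> s * (1 / 2)" using sM M1 by (simp add: \<theta>_def field_simps)
    also have "s * (1 / 2) \<le> s * v y" using v_half[OF that] s by (rule mult_left_mono)
    finally show ?thesis by (simp add: algebra_simps)
  qed
  have v1: "v y = 1" if "y \<notin> ?A" for y using u(5)[OF that] by (simp add: v_def)
  \<comment> \<open>Comparison by induction on time: outside the ball \<open>v\<close> is 1, and
    \<open>bd\<close> applies to the neighbours there because they lie on the sphere.\<close>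
  have "U j y \<le> (1 + s) ^ j * (G * v y)" if "j \<le> m" "y \<in> ?A" for j y
    using that
  proof (induction j arbitrary: y)
    case 0
    then have "0 \<le> v y" using v_half[of y] by simp
    with G have "0 \<le> (1 + s) ^ 0 * (G * v y)" by simp
    with U0[OF 0(2)] show ?case by (rule order_trans)
  next
    case (Suc j)
    have "U (Suc j) y \<le> kop UNIV (\<lambda>x. ((1 + s) ^ j * G) * v x) y"
      unfolding U
    proof (rule kop_mono)
      fix x assume "adj y x"
      show "U j x \<le> ((1 + s) ^ j * G) * v x"
      proof (cases "x \<in> ?A")
        case True
        then show ?thesis using Suc by (simp add: mult.assoc)
      next
        case False
        then show ?thesis
          using bd[of j x] gball_neighbour[OF Suc.prems(2) \<open>adj y x\<close>] Suc.prems(1) v1 by simp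
      qed
    qed
    also have "\<dots> = ((1 + s) ^ j * G) * kop UNIV v y" by (rule kop_cmult)
    also have "\<dots> \<le> ((1 + s) ^ j * G) * ((1 + s) * v y)"
      using Pv[OF Suc.prems(2)] s G by (intro mult_left_mono) auto
    finally show ?case by (simp add: mult_ac)
  qed
  from this[OF order_refl zA] have "U m z \<le> (1 + s) ^ m * (G * v z)" .
  also have "v z \<le> exp (- \<eta> / (2 * C))"
  proof -
    have "\<theta> / C \<le> \<theta> / M * u z"
      using mult_left_mono[OF MC \<theta>(1)] M1 C(1) by (simp add: field_simps)
    then have "v z \<le> 1 + (- \<eta> / (2 * C))" by (simp add: v_def \<theta>_def)
    also have "\<dots> \<le> exp (- \<eta> / (2 * C))" by (rule exp_ge_add_one_self)
    finally show ?thesis .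
  qed
  finally show ?thesis using s G by (simp add: mult_left_mono)
qed

subsection \<open>Hitting distant sets\<close>

lemma E_0: "E z 0 = 0"
proof -
  have *: "gball z 0 = {}" by (simp add: gball_def)
  obtain u where "mean_exit z {} = ennreal (u z)" "u z = 0"
    by (rule mean_exit_bounded[of "{}"]) auto
  then show ?thesis by (simp add: E_def *)
qed

text \<open>\<open>GREATEST\<close> is meaningful only if the admissible \<open>k\<close> are
  bounded. For \<open>k\<close> above the absolute value of \<open>R\<close> the ball in
  \<open>kernel_ok\<close> is empty, so its exit time is 0, less than \<open>n / k\<close>.\<close>

lemma k_point_ok:
  assumes n: "1 \<le> n" and k: "1 \<le> k_point q z n R"
  shows "kernel_ok q z n R (k_point q z n R)"
proof -
  have ex: "\<exists>k. kernel_ok q z n R k"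
    using k by (auto simp: k_point_def split: if_splits)
  have "k \<le> nat \<lceil>\<bar>R\<bar>\<rceil>" if ok: "kernel_ok q z n R k" for k
  proof (rule ccontr)
    assume "\<not> k \<le> nat \<lceil>\<bar>R\<bar>\<rceil>"
    then have k: "\<bar>R\<bar> < real k" by linarith
    then have k0: "0 < real k" by linarith
    have "gball z (of_int \<lfloor>R / real k\<rfloor>) = {}"
    proof -
      have "R / real k < 1" using k k0 by (simp add: divide_less_eq)
      then have "\<lfloor>R / real k\<rfloor> \<le> 0" by linarith
      then have "real_of_int \<lfloor>R / real k\<rfloor> \<le> 0" by linarith
      then show ?thesis
        unfolding gball_def using of_nat_0_le_iff by (auto simp del: of_int_le_0_iff simp: not_less intro: order_trans)
    qed
    moreover have "gball z 0 = {}" by (simp add: gball_def)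
    ultimately have "E z (of_int \<lfloor>R / real k\<rfloor>) = 0"
      using E_0[of z] by (simp add: E_def)
    with ok n k0 show False by (simp add: kernel_ok_def ennreal_eq_0_iff divide_le_0_iff)
  qed
  then have "kernel_ok q z n R (GREATEST k. kernel_ok q z n R k)"
    by (intro GreatestI_ex_nat[OF ex]) blast
  with ex show ?thesis by (simp add: k_point_def)
qed

text \<open>The radius is the floor of \<open>d / k\<close>; it is at least one because radius 0 has
  mean exit time 0, which would make \<open>n / k\<close> vanish.\<close>

lemma k_point_radius:
  assumes n: "1 \<le> n" and K: "1 \<le> K" "K \<le> k_point q z n (real d)"
  obtains k r where "K \<le> k" "1 \<le> r" "r * k \<le> d"
    "ennreal (real n / real k) \<le> ennreal q * E z (real r)"
proof -
  define k where "k = k_point q z n (real d)"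
  define r where "r = d div k"
  have k: "K \<le> k" using K by (simp add: k_def)
  have "kernel_ok q z n (real d) k"
    unfolding k_def using n K by (intro k_point_ok) auto
  moreover have "\<lfloor>real d / real k\<rfloor> = int r"
    unfolding r_def by (rule floor_divide_of_nat_eq)
  ultimately have ok: "ennreal (real n / real k) \<le> ennreal q * E z (real r)"
    by (simp add: kernel_ok_def)
  have "r \<noteq> 0"
  proof
    assume "r = 0"
    then have "real n / real k \<le> 0"
      using ok E_0[of z] by (simp add: ennreal_eq_0_iff)
    then show False using n K k by (simp add: divide_le_0_iff)
  qed
  then show thesis using that[of k r] k ok by (simp add: r_def div_times_less_eq_dividend)
qed

text \<open>Multiplying the admissibility inequality by \<open>K / n\<close> gives the hypothesis of
  \<open>ball_decay\<close> with \<open>\<eta> = K / k\<close> and \<open>s = q * K / n\<close>.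
  This \<open>s\<close> depends on \<open>K\<close> but not on \<open>k\<close>, so excursions from
  different centres can be chained.\<close>

lemma ball_decay_kernel:
  assumes C: "0 < C" "\<And>z. Ebar z (real r) \<le> ennreal C * E z (real r)"
    and n: "1 \<le> n" and K: "1 \<le> K" "K \<le> k" and r: "1 \<le> r" and q: "0 \<le> q"
    and ok: "ennreal (real n / real k) \<le> ennreal q * E z (real r)"
    and G: "0 \<le> G"
    and B: "B \<inter> gball z (real r) = {}"
    and bd: "\<And>j y. j < m \<Longrightarrow> gdist z y = r \<Longrightarrow>
      (kop UNIV ^^ j) (indicator B) y \<le> (1 + q * real K / real n) ^ j * G"
  shows "(kop UNIV ^^ m) (indicator B) z
    \<le> (1 + q * real K / real n) ^ m * (G * exp (- (real K / real k) / (2 * C)))"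
proof (rule ball_decay[OF C r])
  have "ennreal (real K / real k) = ennreal (real K / real n) * ennreal (real n / real k)"
    using n by (simp add: ennreal_mult'[symmetric])
  also have "\<dots> \<le> ennreal (real K / real n) * (ennreal q * E z (real r))"
    using ok by (rule mult_left_mono) simp
  also have "\<dots> = ennreal (q * real K / real n) * E z (real r)"
    using q by (simp add: ennreal_mult'[symmetric] mult.assoc[symmetric] mult.commute)
  finally show "ennreal (real K / real k) \<le> ennreal (q * real K / real n) * E z (real r)" .
  show "(kop UNIV ^^ 0) (indicator B) y \<le> 0" if "y \<in> gball z (real r)" for y
    using that B by (auto simp: indicator_def)
qed (use K q G bd in auto)

lemma kop_pow_indicator_le_1: "(kop UNIV ^^ n) (indicator B) x \<le> 1"
  using kop_pow_mono[where A = UNIV and f = "indicator B" and g = "\<lambda>_. 1"] by (simp add: kop_pow_const indicator_def)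

lemma one_plus_power_le_exp: "0 \<le> s \<Longrightarrow> (1 + s) ^ n \<le> exp (real n * s)"
  using power_mono[of "1 + s" "exp s" n] by (simp add: exp_of_nat_mult)

text \<open>The weight \<open>exp (a K d(x, \<cdot>) / R)\<close> grows along one excursion, from the centre of a ball of
  radius \<open>r \<le> R / k\<close> to its boundary, by at most the factor \<open>exp (a K / k)\<close> that the excursion
  gains. Only the last excursion may overshoot \<open>B(x, R)\<close>, which costs a factor \<open>exp a\<close>.\<close>

lemma hitting_decay:
  assumes C: "0 < C" "\<And>z r. 1 \<le> r \<Longrightarrow> Ebar z (real r) \<le> ennreal C * E z (real r)"
    and n: "1 \<le> n" and K: "1 \<le> K" and R: "1 \<le> R" and q: "0 \<le> q"
    and kp: "\<And>z. z \<in> gball x (real R) \<Longrightarrow> K \<le> k_point q z n (real R)"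
    and B: "\<And>b. b \<in> B \<Longrightarrow> R \<le> gdist x b"
  shows "(kop UNIV ^^ n) (indicator B) x \<le> exp (q * K - (real K - 1) / (2 * C))"
proof -
  define a where "a = 1 / (2 * C)"
  have a: "0 < a" using C by (simp add: a_def)
  define s where "s = q * real K / real n"
  have s: "0 \<le> s" using q by (simp add: s_def)
  \<comment> \<open>Normalised so that \<open>h 0\<close> is the spatial factor wanted at
    \<open>x\<close>, while \<open>h t\<close> reaches 1 at \<open>t = R * (1 - 1 / K)\<close>; from
    there on the bound by 1 is enough.\<close>
  define h where "h t = exp (a * real K * t / real R - a * (real K - 1))" for t
  have hmono: "h t \<le> h t'" if "t \<le> t'" for t t'
    unfolding h_def using that a K R by (simp add: divide_right_mono mult_left_mono)
  have trivial: "(kop UNIV ^^ m) (indicator B) z \<le> (1 + s) ^ m * h t" if "1 \<le> h t" for m z t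
  proof -
    have "1 \<le> (1 + s) ^ m" using s by simp
    then have "1 * 1 \<le> (1 + s) ^ m * h t" using that by (intro mult_mono) auto
    then show ?thesis using kop_pow_indicator_le_1[of m B z] by simp
  qed
  have "(kop UNIV ^^ m) (indicator B) z \<le> (1 + s) ^ m * h (gdist x z)" for m z
  \<comment> \<open>Strong induction, since an excursion may reach the sphere about \<open>z\<close>
    with any smaller number \<open>j\<close> of steps left.\<close>
  proof (induction m arbitrary: z rule: less_induct)
    case (less m)
    show ?case
    proof (cases "gdist x z < R")
      case False
      have "real K * 1 \<le> real K * (gdist x z / real R)"
        using False R by (intro mult_left_mono) (auto simp: le_divide_eq)
      then have "a * (real K - 1) \<le> a * (real K * (gdist x z / real R))"
        using a by (intro mult_left_mono) auto
      then show ?thesis by (intro trivial) (simp add: h_def mult.assoc)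
    next
      case True
      then have "K \<le> k_point q z n (real R)" by (intro kp) (simp add: gball_nat)
      then obtain k r where kr: "K \<le> k" "1 \<le> r" "r * k \<le> R"
        "ennreal (real n / real k) \<le> ennreal q * E z (real r)"
        by (rule k_point_radius[OF n K])
      have k0: "0 < real k" "0 < real R" using kr K R by auto
      have rR: "real r / real R \<le> 1 / real k"
        using kr(3) k0 by (simp add: field_simps of_nat_mult[symmetric] del: of_nat_mult)
      show ?thesis
      proof (cases "gdist x z + r \<le> R")
        case False
        \<comment> \<open>If the ball about \<open>z\<close> may stick out of
          \<open>B(x, R)\<close>, then \<open>z\<close> is within \<open>r\<close>, hence within
          \<open>R / K\<close>, of distance \<open>R\<close> from \<open>x\<close>, and
          \<open>h\<close> is already at least 1 there.\<close>
        have "real K - 1 \<le> real K * (1 - real r / real R)"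
        proof -
          have "real K * (real r / real R) \<le> real K * (1 / real k)"
            using rR by (rule mult_left_mono) simp
          also have "\<dots> \<le> 1" using kr(1) k0 by simp
          finally show ?thesis by (simp add: right_diff_distrib)
        qed
        also have "\<dots> \<le> real K * (gdist x z / real R)"
        proof (rule mult_left_mono)
          have "1 \<le> (real (gdist x z) + real r) / real R"
            using False k0 by (simp add: le_divide_eq)
          then show "1 - real r / real R \<le> real (gdist x z) / real R"
            by (simp add: add_divide_distrib)
        qed simp
        finally have "a * (real K - 1) \<le> a * (real K * (gdist x z / real R))"
          using a by (intro mult_left_mono) auto
        then show ?thesis by (intro trivial) (simp add: h_def mult.assoc)
      next
        case inside: True
        let ?G = "h (real (gdist x z + r))"
        have disj: "B \<inter> gball z (real r) = {}"
        proof -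
          have "gdist x y < R" if "gdist z y < r" for y
            using gdist_triangle[of x y z] that inside by linarith
          then show ?thesis using B by (force simp: gball_nat)
        qed
        have "(kop UNIV ^^ m) (indicator B) z
            \<le> (1 + q * real K / real n) ^ m * (?G * exp (- (real K / real k) / (2 * C)))"
        proof (rule ball_decay_kernel[OF C(1) C(2)[OF kr(2)] n K kr(1,2) q kr(4) _ disj])
          show "0 \<le> ?G" by (simp add: h_def)
          fix j y assume j: "j < m" and y: "gdist z y = r"
          have "h (real (gdist x y)) \<le> ?G"
            using gdist_triangle[of x y z] y by (intro hmono) simp
          then show "(kop UNIV ^^ j) (indicator B) y \<le> (1 + q * real K / real n) ^ j * ?G"
            using less.IH[OF j, of y] s
            by (fold s_def) (meson order_trans mult_left_mono zero_le_power add_nonneg_nonneg zero_le_one)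
        qed
        \<comment> \<open>Crossing the ball raises the exponent of \<open>h\<close> by
          \<open>a * K * r / R\<close>, at most \<open>a * K / k\<close>, which is what the
          excursion gains.\<close>
        also have "?G * exp (- (real K / real k) / (2 * C)) \<le> h (gdist x z)"
        proof -
          have "a * real K * (real r / real R) \<le> a * real K * (1 / real k)"
            using rR a by (intro mult_left_mono) auto
          then show ?thesis
            by (simp add: h_def exp_add[symmetric] a_def add_divide_distrib distrib_left mult.commute)
        qed
        finally show ?thesis using s by (simp add: s_def mult_left_mono)
      qed
    qed
  qed
  from this[of n x] have "(kop UNIV ^^ n) (indicator B) x \<le> (1 + s) ^ n * exp (- (a * (real K - 1)))"
    by (simp add: h_def)
  also have "\<dots> \<le> exp (real n * s) * exp (- (a * (real K - 1)))"
    using one_plus_power_le_exp[OF s] by (rule mult_right_mono) simp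
  also have "\<dots> = exp (q * K - (real K - 1) / (2 * C))"
    using n by (simp add: s_def a_def exp_add[symmetric])
  finally show ?thesis .
qed

text \<open>For \<open>K = 1\<close> the overshoot in \<open>hitting_decay\<close> uses up the whole
  gain. At distance one the ball is just the vertex \<open>x\<close>, and bounding by 1 on its
  sphere preserves the full gain of one excursion.\<close>

lemma hitting_decay_neighbours:
  assumes C: "0 < C" "\<And>z r. 1 \<le> r \<Longrightarrow> Ebar z (real r) \<le> ennreal C * E z (real r)"
    and n: "1 \<le> n" and q: "0 \<le> q"
    and kp: "1 \<le> k_point q x n 1"
    and B: "x \<notin> B"
  shows "(kop UNIV ^^ n) (indicator B) x \<le> exp (q - 1 / (2 * C))"
proof -
  from kp have "1 \<le> k_point q x n (real 1)" by simp
  then obtain k r where kr: "1 \<le> k" "1 \<le> r" "r * k \<le> 1"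
    "ennreal (real n / real k) \<le> ennreal q * E x (real r)"
    by (rule k_point_radius[OF n order_refl])
  \<comment> \<open>Two positive integers with product at most 1.\<close>
  then have 1: "k = 1" "r = 1"
    using order_trans[OF mult_le_mono1[of 1 r k]] order_trans[OF mult_le_mono2[of 1 k r]]
    by (fastforce intro: antisym)+
  have s: "0 \<le> q / real n" using q by simp
  have "(kop UNIV ^^ n) (indicator B) x
      \<le> (1 + q * real 1 / real n) ^ n * (1 * exp (- (real 1 / real k) / (2 * C)))"
  proof (rule ball_decay_kernel[OF C(1) C(2)[OF kr(2)] n order_refl kr(1,2) q kr(4)])
    show "B \<inter> gball x (real r) = {}" using B by (auto simp: 1 gball_def)
    fix j y
    have "1 \<le> (1 + q / real n) ^ j" using s by simp
    then show "(kop UNIV ^^ j) (indicator B) y \<le> (1 + q * real 1 / real n) ^ j * 1"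
      using kop_pow_indicator_le_1[of j B y] by simp
  qed simp
  also have "\<dots> \<le> exp (real n * (q / real n)) * exp (- 1 / (2 * C))"
    using one_plus_power_le_exp[OF s, of n] by (simp add: 1 mult_right_mono)
  also have "\<dots> = exp (q - 1 / (2 * C))" using n by (simp add: exp_add[symmetric])
  finally show ?thesis .
qed

subsection \<open>Reversibility\<close>

text \<open>The inner product of L2(mu) for nonnegative functions, in \<open>ennreal\<close> so that
  no summability has to be shown.\<close>

definition dot :: "('a \<Rightarrow> real) \<Rightarrow> ('a \<Rightarrow> real) \<Rightarrow> ennreal" where
  "dot f g = (\<integral>\<^sup>+ x. ennreal (mu x * f x * g x) \<partial>count_space UNIV)"

lemma dot_commute: "dot f g = dot g f"
  by (simp add: dot_def mult_ac)

lemma mu_nonneg [simp]: "0 \<le> mu x"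
  using mu_pos[of x] by simp

lemma dot_mono:
  assumes "\<And>x. 0 \<le> f x" "\<And>x. g x \<le> h x"
  shows "dot f g \<le> dot f h"
  unfolding dot_def using assms by (intro nn_integral_mono ennreal_leI mult_left_mono) auto

text \<open>Since \<open>mu x * trans_prob x v = w x v\<close>, the form becomes a double sum
  against the symmetric weights; swapping the sums then gives self-adjointness.\<close>

lemma dot_kop:
  assumes f: "\<And>x. 0 \<le> f x" and g: "\<And>x. 0 \<le> g x"
  shows "dot f (kop UNIV g) = (\<integral>\<^sup>+ x. \<integral>\<^sup>+ v. ennreal (w x v * f x * g v) \<partial>count_space UNIV \<partial>count_space UNIV)"
  unfolding dot_def
proof (intro nn_integral_cong)
  fix x
  have "(\<integral>\<^sup>+ v. ennreal (w x v * f x * g v) \<partial>count_space UNIV)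
      = (\<Sum>v | adj x v. ennreal (w x v * f x * g v))"
    by (intro nn_integral_count_space') (auto simp: weight_zero)
  also have "\<dots> = ennreal (\<Sum>v | adj x v. w x v * f x * g v)"
    using f g by (intro sum_ennreal) (simp add: weight_nonneg)
  also have "(\<Sum>v | adj x v. w x v * f x * g v) = mu x * f x * kop UNIV g x"
    unfolding kop_def sum_distrib_left using mu_pos[of x]
    by (intro sum.cong) (auto simp: trans_prob_def)
  finally show "ennreal (mu x * f x * kop UNIV g x)
      = (\<integral>\<^sup>+ v. ennreal (w x v * f x * g v) \<partial>count_space UNIV)" ..
qed

lemma dot_kop_self_adjoint:
  assumes f: "\<And>x. 0 \<le> f x" and g: "\<And>x. 0 \<le> g x"
  shows "dot f (kop UNIV g) = dot (kop UNIV f) g"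
proof -
  have "dot f (kop UNIV g)
      = (\<integral>\<^sup>+ v. \<integral>\<^sup>+ x. ennreal (w x v * f x * g v) \<partial>count_space UNIV \<partial>count_space UNIV)"
    unfolding dot_kop[OF assms]
    by (rule nn_integral_count_space_nn_integral) (auto simp: countable_vertices)
  also have "\<dots> = dot g (kop UNIV f)"
    unfolding dot_kop[OF g f] by (simp add: weight_sym mult_ac)
  finally show ?thesis by (simp add: dot_commute)
qed

lemma dot_kop_pow:
  assumes f: "\<And>x. 0 \<le> f x" and g: "\<And>x. 0 \<le> g x"
  shows "dot f ((kop UNIV ^^ n) g) = dot ((kop UNIV ^^ n) f) g"
  using f
proof (induction n arbitrary: f)
  case (Suc n)
  have "dot f ((kop UNIV ^^ Suc n) g) = dot (kop UNIV f) ((kop UNIV ^^ n) g)"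
    using dot_kop_self_adjoint[OF Suc.prems kop_pow_nonneg[OF g]] by simp
  also have "\<dots> = dot ((kop UNIV ^^ n) (kop UNIV f)) g"
    by (intro Suc.IH kop_nonneg Suc.prems)
  finally show ?case by (simp add: funpow_swap1)
qed simp

lemma dot_indicator:
  assumes "finite A" "\<And>x. 0 \<le> f x"
  shows "dot (indicator A) f = ennreal (\<Sum>x\<in>A. mu x * f x)"
proof -
  have "dot (indicator A) f = (\<Sum>x\<in>A. ennreal (mu x * indicator A x * f x))"
    unfolding dot_def using assms by (intro nn_integral_count_space') auto
  then show ?thesis using assms by (simp add: sum_ennreal)
qed

text \<open>If \<open>a = P\<^sup>m f\<close> and \<open>b = P\<^sup>m g\<close>, then \<open>a + b \<le> 1\<close> gives \<open>a\<^sup>2 \<le> a - a b\<close> and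
  \<open>b\<^sup>2 \<le> b - a b\<close>; integrate \<open>2 (F G)\<^sup>1\<^sup>/\<^sup>2 a b \<le> G a\<^sup>2 + F b\<^sup>2\<close>.\<close>

lemma dot_pow_disjoint_le_half:
  assumes f: "\<And>x. 0 \<le> f x" and g: "\<And>x. 0 \<le> g x" and fg: "\<And>x. f x + g x \<le> 1"
    and F: "dot f (\<lambda>_. 1) = ennreal F" "0 \<le> F" and G: "dot g (\<lambda>_. 1) = ennreal G" "0 \<le> G"
  shows "dot ((kop UNIV ^^ m) f) ((kop UNIV ^^ m) g) \<le> ennreal (sqrt (F * G) / 2)"
proof -
  define a where "a = (kop UNIV ^^ m) f"
  define b where "b = (kop UNIV ^^ m) g"
  have a: "0 \<le> a x" and b: "0 \<le> b x" for x
    unfolding a_def b_def using f g by (auto intro: kop_pow_nonneg)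
  have ab: "a x + b x \<le> 1" for x
    using kop_pow_mono[where f = "\<lambda>x. f x + g x" and g = "\<lambda>_. 1" and A = UNIV and n = m and x = x, OF fg]
    by (simp add: kop_pow_add kop_pow_const a_def b_def)
  \<comment> \<open>The powers of the operator are self-adjoint and fix constants, so
    \<open>a\<close> has the same mass as \<open>f\<close>.\<close>
  have "dot a (\<lambda>_. 1) = ennreal F"
    unfolding a_def using dot_kop_pow[where f = f and g = "\<lambda>_. 1" and n = m, OF f] by (simp add: kop_pow_const F)
  moreover have "dot a (\<lambda>x. a x + b x) = dot a a + dot a b"
    unfolding dot_def distrib_left
    using a b by (subst nn_integral_add[symmetric]) (auto simp: ennreal_plus intro!: nn_integral_cong)
  ultimately have p: "dot a a + dot a b \<le> ennreal F"
    using dot_mono[where f = a and g = "\<lambda>x. a x + b x" and h = "\<lambda>_. 1", OF a ab] by simp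
  have "dot b (\<lambda>_. 1) = ennreal G"
    unfolding b_def using dot_kop_pow[where f = g and g = "\<lambda>_. 1" and n = m, OF g] by (simp add: kop_pow_const G)
  moreover have "dot b (\<lambda>x. a x + b x) = dot a b + dot b b"
    unfolding dot_def distrib_left
    using a b by (subst nn_integral_add[symmetric]) (auto simp: ennreal_plus mult_ac intro!: nn_integral_cong)
  ultimately have r: "dot b b + dot a b \<le> ennreal G"
    using dot_mono[where f = b and g = "\<lambda>x. a x + b x" and h = "\<lambda>_. 1", OF b ab] by (simp add: add.commute)
  have fin: "dot a a < \<top>" "dot a b < \<top>" "dot b b < \<top>"
    using p r by (auto simp: less_top[symmetric] top_unique)
  obtain p' where p': "dot a a = ennreal p'" "0 \<le> p'"
    using fin(1) by (cases "dot a a") auto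
  obtain r' where r': "dot b b = ennreal r'" "0 \<le> r'"
    using fin(3) by (cases "dot b b") auto
  obtain t where t: "dot a b = ennreal t" "0 \<le> t"
    using fin(2) by (cases "dot a b") auto
  define S where "S = sqrt (F * G)"
  have S: "0 \<le> S" "S * S = F * G" using F G by (auto simp: S_def)
  have pt: "p' + t \<le> F" and rt: "r' + t \<le> G"
    using p r F G p' r' t by (simp_all add: ennreal_plus[symmetric] del: ennreal_plus)
  have "ennreal (2 * S) * dot a b \<le> ennreal G * dot a a + ennreal F * dot b b"
  proof -
    have "ennreal (2 * S) * ennreal (mu x * a x * b x)
      \<le> ennreal G * ennreal (mu x * a x * a x) + ennreal F * ennreal (mu x * b x * b x)" for x
    proof -
      have "0 \<le> (sqrt G * a x - sqrt F * b x)\<^sup>2" by simp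
      also have "\<dots> = G * (a x)\<^sup>2 + F * (b x)\<^sup>2 - 2 * S * (a x * b x)"
        using F G by (simp add: S_def power2_diff power_mult_distrib real_sqrt_mult)
      finally have "2 * S * (a x * b x) \<le> G * a x * a x + F * b x * b x"
        by (simp add: power2_eq_square mult.assoc)
      then have "mu x * (2 * S * (a x * b x)) \<le> mu x * (G * a x * a x + F * b x * b x)"
        by (intro mult_left_mono) auto
      then show ?thesis
        using F G S a[of x] b[of x]
        by (simp add: ennreal_mult'[symmetric] ennreal_plus[symmetric] algebra_simps del: ennreal_plus)
    qed
    then have "(\<integral>\<^sup>+ x. ennreal (2 * S) * ennreal (mu x * a x * b x) \<partial>count_space UNIV)
      \<le> (\<integral>\<^sup>+ x. ennreal G * ennreal (mu x * a x * a x) + ennreal F * ennreal (mu x * b x * b x)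
           \<partial>count_space UNIV)"
      by (intro nn_integral_mono)
    then show ?thesis
      by (simp add: nn_integral_cmult nn_integral_add dot_def)
  qed
  then have "2 * S * t \<le> G * p' + F * r'"
    using F G S p' r' t
    by (simp add: ennreal_mult'[symmetric] ennreal_plus[symmetric] del: ennreal_plus)
  also have "\<dots> \<le> G * (F - t) + F * (G - t)"
    using pt rt F G by (intro add_mono mult_left_mono) auto
  also have "\<dots> = 2 * (S * S) - (F + G) * t" using S by (simp add: algebra_simps)
  finally have "2 * S * t \<le> 2 * (S * S) - (F + G) * t" .
  \<comment> \<open>Arithmetic-geometric mean, which turns the previous bound into
    \<open>4 * S * t \<le> 2 * S * S\<close>. Cancelling \<open>S\<close> requires the case
    \<open>S = 0\<close> apart: there \<open>F\<close> or \<open>G\<close> is 0, which forces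
    \<open>t = 0\<close>.\<close>
  moreover have "2 * S * t \<le> (F + G) * t"
    using arith_geo_mean_sqrt[of F G] F G t by (intro mult_right_mono) (auto simp: S_def)
  ultimately have "S * (2 * t) \<le> S * S" by linarith
  moreover have "t \<le> 0" if "S = 0"
  proof -
    have "F = 0 \<or> G = 0" using that F G by (simp add: S_def)
    then show ?thesis using pt rt p' r' by auto
  qed
  ultimately have "2 * t \<le> S"
    using S(1) by (cases "S = 0") auto
  then have "t \<le> S / 2" by simp
  then show ?thesis unfolding a_def[symmetric] b_def[symmetric] t(1) S_def by (rule ennreal_leI)
qed

text \<open>Writing \<open>n\<close> as 2m or 2m + 1, the odd step, if any, is given to
  \<open>A\<close>. It spreads the indicator only to neighbours of \<open>A\<close>, which are not
  in \<open>B\<close>, so the sum with the indicator of \<open>B\<close> still stays below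
  1.\<close>

lemma transition_mass_le_half:
  assumes A: "finite A" and B: "finite B" and AB: "\<And>a b. a \<in> A \<Longrightarrow> b \<in> B \<Longrightarrow> 2 \<le> gdist a b"
  shows "(\<Sum>x\<in>A. mu x * (kop UNIV ^^ n) (indicator B) x) \<le> sqrt (sum mu A * sum mu B) / 2"
proof -
  define m where "m = n div 2"
  define f where "f = (kop UNIV ^^ (n - 2 * m)) (indicator A)"
  let ?B = "indicator B :: 'a \<Rightarrow> real"
  have n: "n = (n - 2 * m) + m + m" by (simp add: m_def)
  have f0: "0 \<le> f x" for x unfolding f_def by (rule kop_pow_nonneg) simp
  have f1: "f x \<le> 1" for x unfolding f_def by (rule kop_pow_indicator_le_1)
  have fB: "f x = 0" if x: "x \<in> B" for x
  proof -
    have "n - 2 * m = 0 \<or> n - 2 * m = 1" by (simp add: m_def) presburger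
    moreover have "kop UNIV (indicator A) x = 0"
    proof -
      have "kop UNIV (indicator A) x = kop UNIV (\<lambda>_. 0) x"
      proof (rule kop_cong)
        fix y assume "adj x y"
        then have "gdist y x \<le> 1" by (intro gdist_adj_le) (simp add: adj_sym)
        then show "indicator A y = (0::real)" using AB[OF _ x, of y] by (auto simp: indicator_def)
      qed
      then show ?thesis by (simp add: kop_const)
    qed
    moreover have "x \<notin> A" using AB[OF _ x, of x] by auto
    ultimately show ?thesis by (auto simp: f_def)
  qed
  have pow: "(kop UNIV ^^ n) ?B = (kop UNIV ^^ (n - 2 * m)) ((kop UNIV ^^ m) ((kop UNIV ^^ m) ?B))"
    by (subst n) (simp add: funpow_add)
  have "ennreal (\<Sum>x\<in>A. mu x * (kop UNIV ^^ n) ?B x) = dot (indicator A) ((kop UNIV ^^ n) ?B)"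
    using A by (intro dot_indicator[symmetric] kop_pow_nonneg) simp_all
  also have "\<dots> = dot ((kop UNIV ^^ m) f) ((kop UNIV ^^ m) ?B)"
    unfolding f_def pow by (simp add: dot_kop_pow kop_pow_nonneg)
  also have "\<dots> \<le> ennreal (sqrt (sum mu A * sum mu B) / 2)"
  proof (rule dot_pow_disjoint_le_half)
    show "f x + ?B x \<le> 1" for x using fB[of x] f1[of x] by (auto simp: indicator_def)
    have "dot f (\<lambda>_. 1) = dot (indicator A) ((kop UNIV ^^ (n - 2 * m)) (\<lambda>_. 1))"
      unfolding f_def by (intro dot_kop_pow[symmetric]) auto
    also have "\<dots> = dot (indicator A) (\<lambda>_. 1)" by (simp add: kop_pow_const)
    finally show "dot f (\<lambda>_. 1) = ennreal (sum mu A)" using A by (simp add: dot_indicator)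
    show "dot ?B (\<lambda>_. 1) = ennreal (sum mu B)" using B by (simp add: dot_indicator)
  qed (auto simp: f0 sum_nonneg)
  finally show ?thesis by (simp add: sum_nonneg)
qed

lemma transition_mass_commute:
  assumes "finite A" "finite B"
  shows "(\<Sum>x\<in>A. mu x * (kop UNIV ^^ n) (indicator B) x) = (\<Sum>x\<in>B. mu x * (kop UNIV ^^ n) (indicator A) x)"
proof -
  let ?S = "\<lambda>A B. \<Sum>x\<in>A. mu x * (kop UNIV ^^ n) (indicator B :: 'a \<Rightarrow> real) x"
  have eq: "ennreal (?S A B) = dot (indicator A) ((kop UNIV ^^ n) (indicator B))" if "finite A" for A B
    using that by (intro dot_indicator[symmetric] kop_pow_nonneg) simp_all
  have "ennreal (?S A B) = ennreal (?S B A)"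
    unfolding eq[OF assms(1)] eq[OF assms(2)] dot_commute[of "indicator B"]
    by (intro dot_kop_pow) auto
  moreover have "0 \<le> ?S A B" for A B
    by (intro sum_nonneg mult_nonneg_nonneg kop_pow_nonneg) auto
  ultimately show ?thesis by simp
qed

text \<open>The hypothesis bounds the mass by \<open>sum mu A * exp e\<close>, and reversibility
  bounds it by \<open>sum mu B\<close>; the geometric mean of the two halves the exponent.\<close>

lemma transition_mass_le:
  assumes A: "finite A" and B: "finite B" and e: "\<And>x. x \<in> A \<Longrightarrow> (kop UNIV ^^ n) (indicator B) x \<le> exp e"
  shows "(\<Sum>x\<in>A. mu x * (kop UNIV ^^ n) (indicator B) x) \<le> sqrt (sum mu A * sum mu B) * exp (e / 2)"
proof -
  let ?T = "\<Sum>x\<in>A. mu x * (kop UNIV ^^ n) (indicator B) x"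
  have "?T \<le> (\<Sum>x\<in>A. mu x * exp e)" using e by (intro sum_mono mult_left_mono) auto
  then have 1: "?T \<le> sum mu A * exp e" by (simp add: sum_distrib_right)
  have "?T \<le> (\<Sum>y\<in>B. mu y * 1)"
    unfolding transition_mass_commute[OF A B]
    using kop_pow_indicator_le_1 by (intro sum_mono mult_left_mono) auto
  then have 2: "?T \<le> sum mu B" by simp
  have 0: "0 \<le> ?T" by (intro sum_nonneg mult_nonneg_nonneg kop_pow_nonneg) auto
  have "?T * ?T \<le> (sum mu A * exp e) * sum mu B"
    using 1 2 0 by (intro mult_mono) (auto simp: sum_nonneg)
  then have "?T \<le> sqrt ((sum mu A * sum mu B) * exp e)"
    by (intro real_le_rsqrt) (simp add: power2_eq_square mult_ac)
  also have "\<dots> = sqrt (sum mu A * sum mu B) * exp (e / 2)"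
    using real_sqrt_unique[of "exp (e / 2)" "exp e"]
    by (simp add: real_sqrt_mult power2_eq_square exp_add[symmetric])
  finally show ?thesis .
qed

subsection \<open>The integrated estimate\<close>

text \<open>Only lower bounds \<open>d\<close> and \<open>K\<close> are asked for, so that finite
  subsets may use the values belonging to the full sets.\<close>

lemma transition_mass_decay:
  fixes n :: nat
  assumes C: "0 < C" "\<And>z r. 1 \<le> r \<Longrightarrow> Ebar z (real r) \<le> ennreal C * E z (real r)"
    and c: "c \<le> ln 2" "c \<le> 1 / (16 * C)" and n: "1 \<le> n"
    and A: "finite A" and B: "finite B"
    and d: "\<And>a b. a \<in> A \<Longrightarrow> b \<in> B \<Longrightarrow> d \<le> gdist a b"
    and K: "d = 0 \<Longrightarrow> K = 0"
      "\<And>x z. x \<in> A \<Longrightarrow> z \<in> gball x (real d) \<Longrightarrow> K \<le> k_point (1 / (8 * C)) z n (real d)"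
  shows "(\<Sum>x\<in>A. mu x * (kop UNIV ^^ n) (indicator B) x)
    \<le> sqrt (sum mu A * sum mu B) * exp (- c * real K)"
proof -
  let ?T = "\<Sum>x\<in>A. mu x * (kop UNIV ^^ n) (indicator B) x"
  \<comment> \<open>The choice \<open>q = a / 4\<close> makes the loss \<open>q * K\<close> a
    quarter of the gain \<open>a * K\<close>.\<close>
  define a where "a = 1 / (2 * C)"
  have a: "0 < a" "1 / (8 * C) = a / 4" "c \<le> a / 8" using C c by (auto simp: a_def)
  have weaken: "?T \<le> sqrt (sum mu A * sum mu B) * exp (- c * real K)"
    if "?T \<le> sqrt (sum mu A * sum mu B) * exp e" "e \<le> - c * real K" for e
  proof -
    note that(1)
    also have "sqrt (sum mu A * sum mu B) * exp e \<le> sqrt (sum mu A * sum mu B) * exp (- c * real K)"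
      using that(2) by (intro mult_left_mono) (auto simp: sum_nonneg)
    finally show ?thesis .
  qed
  consider "K = 0" | "K = 1" "d \<ge> 2" | "K = 1" "d = 1" | "K \<ge> 2" "d \<ge> 1"
    using K(1) by fastforce
  then show ?thesis
  proof cases
    case 1
    have "?T \<le> sqrt (sum mu A * sum mu B) * exp (0 / 2)"
      using kop_pow_indicator_le_1 by (intro transition_mass_le A B) simp
    with 1 show ?thesis by simp
  next
    case 2
    have "?T \<le> sqrt (sum mu A * sum mu B) / 2"
      using d 2 by (intro transition_mass_le_half A B) (meson order_trans)
    also have "\<dots> = sqrt (sum mu A * sum mu B) * exp (- ln 2)"
      by (simp add: exp_minus)
    finally show ?thesis using c 2 by (intro weaken) auto
  next
    case 3
    have "?T \<le> sqrt (sum mu A * sum mu B) * exp ((a / 4 - 1 / (2 * C)) / 2)"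
    proof (intro transition_mass_le A B hitting_decay_neighbours[OF C n])
      fix x assume x: "x \<in> A"
      have "x \<in> gball x (real d)" using 3 by (simp add: gball_def)
      from K(2)[OF x this] show "1 \<le> k_point (a / 4) x n 1" using 3 a by simp
      show "x \<notin> B" using d[OF x, of x] 3 by auto
    qed (use a in auto)
    then show ?thesis
      by (rule weaken) (use a 3 in \<open>simp add: a_def[symmetric]\<close>)
  next
    case 4
    have "?T \<le> sqrt (sum mu A * sum mu B) * exp ((a / 4 * real K - (real K - 1) / (2 * C)) / 2)"
    proof (intro transition_mass_le A B hitting_decay[OF C n])
      fix x z assume "x \<in> A" "z \<in> gball x (real d)"
      then show "K \<le> k_point (a / 4) z n (real d)" using K(2) a by simp
    qed (use a 4 d in auto)
    then show ?thesis
    proof (rule weaken)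
      have eq: "(real K - 1) / (2 * C) = a * (real K - 1)" by (simp add: a_def)
      \<comment> \<open>The exponent equals \<open>a / 2 - 3 * a * K / 8\<close>, which is at most
        \<open>- a * K / 8\<close> exactly when \<open>K\<close> is at least 2.\<close>
      have "a * 2 \<le> a * real K" "c * real K \<le> a / 8 * real K"
        using 4 a by (auto intro!: mult_right_mono)
      then show "(a / 4 * real K - (real K - 1) / (2 * C)) / 2 \<le> - c * real K"
        unfolding eq by (simp add: field_simps)
    qed
  qed
qed

section \<open>From finite sets to arbitrary sets\<close>

lemma nn_integral_count_space_le_finite:
  fixes f :: "'b \<Rightarrow> ennreal"
  assumes X: "countable X" and le: "\<And>F. finite F \<Longrightarrow> F \<subseteq> X \<Longrightarrow> (\<Sum>x\<in>F. f x) \<le> c"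
  shows "(\<integral>\<^sup>+ x. f x \<partial>count_space X) \<le> c"
proof -
  \<comment> \<open>An enumeration of \<open>X\<close> exhausts it by finite sets, and monotone
    convergence applies.\<close>
  define F where "F n = {x \<in> X. to_nat_on X x < n}" for n
  have fin: "finite (F n)" for n
  proof (rule finite_imageD)
    show "finite (to_nat_on X ` F n)" by (rule finite_subset[of _ "{..<n}"]) (auto simp: F_def)
    show "inj_on (to_nat_on X) (F n)"
      using inj_on_to_nat_on[OF X] by (rule inj_on_subset) (auto simp: F_def)
  qed
  have "(\<integral>\<^sup>+ x. f x \<partial>count_space X) = (\<integral>\<^sup>+ x. (SUP n. f x * indicator (F n) x) \<partial>count_space X)"
  proof (intro nn_integral_cong antisym SUP_least)
    fix x n assume "x \<in> space (count_space X)"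
    then have "x \<in> F (Suc (to_nat_on X x))" by (simp add: F_def)
    then have "f x = f x * indicator (F (Suc (to_nat_on X x))) x" by simp
    also have "\<dots> \<le> (SUP n. f x * indicator (F n) x)" by (rule SUP_upper) simp
    finally show "f x \<le> (SUP n. f x * indicator (F n) x)" .
    show "f x * indicator (F n) x \<le> f x" by (simp add: indicator_def)
  qed
  also have "\<dots> = (SUP n. \<integral>\<^sup>+ x. f x * indicator (F n) x \<partial>count_space X)"
    by (intro nn_integral_monotone_convergence_SUP)
      (auto simp: incseq_def le_fun_def F_def indicator_def)
  also have "\<dots> \<le> c"
  proof (rule SUP_least)
    fix n
    have "(\<integral>\<^sup>+ x. f x * indicator (F n) x \<partial>count_space X) = (\<Sum>x\<in>F n. f x * indicator (F n) x)"
      by (intro nn_integral_count_space' fin) (auto simp: F_def)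
    also have "\<dots> = (\<Sum>x\<in>F n. f x)" by (intro sum.cong) auto
    also have "\<dots> \<le> c" by (intro le fin) (auto simp: F_def)
    finally show "(\<integral>\<^sup>+ x. f x * indicator (F n) x \<partial>count_space X) \<le> c" .
  qed
  finally show ?thesis .
qed

lemma sum_mu_le_mu_set:
  assumes "finite F" "F \<subseteq> A"
  shows "ennreal (sum mu F) \<le> mu_set A"
proof -
  have "ennreal (sum mu F) = (\<integral>\<^sup>+ y. ennreal (mu y) \<partial>count_space F)"
    using assms by (simp add: nn_integral_count_space_finite)
  also have "\<dots> = (\<integral>\<^sup>+ y. ennreal (mu y) * indicator F y \<partial>count_space UNIV)"
    by (rule nn_integral_count_space_indicator) simp
  also have "\<dots> \<le> (\<integral>\<^sup>+ y. ennreal (mu y) * indicator A y \<partial>count_space UNIV)"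
    using assms by (intro nn_integral_mono) (auto simp: indicator_def)
  also have "\<dots> = mu_set A"
    unfolding mu_set_def by (rule nn_integral_count_space_indicator[symmetric]) simp
  finally show ?thesis .
qed

lemma mu_set_pos: "A \<noteq> {} \<Longrightarrow> mu_set A \<noteq> 0"
proof -
  assume "A \<noteq> {}"
  then obtain x where "x \<in> A" by auto
  then show ?thesis using sum_mu_le_mu_set[of "{x}" A] mu_pos[of x] by (auto simp: ennreal_eq_0_iff)
qed

text \<open>Minima over \<open>A\<close> and \<open>B\<close> are lower bounds over the finite parts
  \<open>F\<close> and \<open>H\<close>, so \<open>transition_mass_decay\<close> applies with
  constants independent of these parts.\<close>

lemma transition_mass_decay_k_sets:
  fixes n :: nat
  assumes C: "0 < C" "\<And>z r. 1 \<le> r \<Longrightarrow> Ebar z (real r) \<le> ennreal C * E z (real r)"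
    and c: "c \<le> ln 2" "c \<le> 1 / (16 * C)" and n: "1 \<le> n"
    and F: "finite F" "F \<subseteq> A" "finite H" "H \<subseteq> B"
  shows "(\<Sum>x\<in>F. mu x * (kop UNIV ^^ n) (indicator H) x)
    \<le> sqrt (sum mu F * sum mu H) * exp (- c * real (k_sets (1 / (8 * C)) n A B))"
proof (cases "F = {}")
  case False
  then obtain x0 where x0: "x0 \<in> A" using F by auto
  have low: "k_sets q n A B \<le> k_ball q x n (real (set_dist A B))" if "x \<in> A" for x q
    unfolding k_sets_def using that by (intro cINF_lower) auto
  show ?thesis
  proof (rule transition_mass_decay[OF C c n F(1) F(3)])
    show "set_dist A B \<le> gdist a b" if "a \<in> F" "b \<in> H" for a b
    proof -
      have "(INF p\<in>A \<times> B. case p of (a, b) \<Rightarrow> gdist a b) \<le> (case (a, b) of (a, b) \<Rightarrow> gdist a b)"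
        using that F by (intro cINF_lower) auto
      then show ?thesis by (simp add: set_dist_def)
    qed
    show "k_sets (1 / (8 * C)) n A B = 0" if "set_dist A B = 0"
      using low[OF x0, of "1 / (8 * C)"] that by (simp add: k_ball_def)
    fix x z assume x: "x \<in> F" and z: "z \<in> gball x (real (set_dist A B))"
    let ?d = "real (set_dist A B)"
    have "(INF z\<in>gball x ?d. k_point (1 / (8 * C)) z n ?d) \<le> k_point (1 / (8 * C)) z n ?d"
      using z by (intro cINF_lower) auto
    \<comment> \<open>A nonempty ball excludes the default value 0 of \<open>k_ball\<close>.\<close>
    moreover have "?d \<noteq> 0" using z by (auto simp: gball_def)
    ultimately show "k_sets (1 / (8 * C)) n A B \<le> k_point (1 / (8 * C)) z n ?d"
      using low[of x "1 / (8 * C)"] x F by (auto simp: k_ball_def intro: order_trans)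
  qed
qed simp

lemma transition_mass_decay_kappa:
  fixes n :: nat
  assumes C: "0 < C" "\<And>z r. 1 \<le> r \<Longrightarrow> Ebar z (real r) \<le> ennreal C * E z (real r)"
    and c: "c \<le> ln 2" "c \<le> 1 / (16 * C)" and n: "1 \<le> n"
    and AB: "A \<noteq> {}" "B \<noteq> {}"
  shows "(\<integral>\<^sup>+ (x, y). ennreal (pn n x y * mu x * mu y) \<partial>count_space (A \<times> B))
    \<le> ennreal_sqrt (mu_set A * mu_set B) * ennreal (exp (- c * real (kappa (1 / (8 * C)) n A B)))"
proof (cases "mu_set A = \<infinity> \<or> mu_set B = \<infinity>")
  case True
  \<comment> \<open>Both measures are nonzero, so the product is not the degenerate 0 times
    infinity, and the right-hand side is infinite.\<close>
  then have "mu_set A * mu_set B = \<infinity>"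
    using mu_set_pos[OF AB(1)] mu_set_pos[OF AB(2)] by (auto simp: ennreal_mult_eq_top_iff)
  then show ?thesis by (simp add: ennreal_sqrt_def ennreal_top_mult ennreal_eq_0_iff)
next
  case False
  then obtain \<alpha> \<beta> where \<alpha>: "mu_set A = ennreal \<alpha>" "0 \<le> \<alpha>" and \<beta>: "mu_set B = ennreal \<beta>" "0 \<le> \<beta>"
    by (metis ennreal_cases infinity_ennreal_def)
  let ?q = "1 / (8 * C)"
  let ?e = "exp (- c * real (kappa ?q n A B))"
  let ?U = "\<lambda>H. (kop UNIV ^^ n) (indicator H :: 'a \<Rightarrow> real)"
  have rhs: "ennreal_sqrt (mu_set A * mu_set B) * ennreal ?e = ennreal (sqrt (\<alpha> * \<beta>) * ?e)"
    using \<alpha> \<beta> by (simp add: ennreal_sqrt_def ennreal_mult[symmetric])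
  have eq: "pn n x y * mu x * mu y = mu x * Pn n x y" for x y
    using mu_pos[of y] by (simp add: pn_def)
  have Pn0: "0 \<le> Pn n x y" for x y by (simp add: Pn_def)
  have main: "(\<Sum>x\<in>F. mu x * ?U H x) \<le> sqrt (\<alpha> * \<beta>) * ?e"
    if F: "finite F" "F \<subseteq> A" "finite H" "H \<subseteq> B" for F H
  proof -
    have "(\<Sum>x\<in>F. mu x * ?U H x) \<le> sqrt (sum mu F * sum mu H) * exp (- c * real (k_sets ?q n A B))"
      using transition_mass_decay_k_sets[OF C c n F] .
    \<comment> \<open>Reversibility exchanges the two sets, which supplies the other term of the
      maximum in \<open>kappa\<close>.\<close>
    moreover have "(\<Sum>x\<in>F. mu x * ?U H x)
        \<le> sqrt (sum mu F * sum mu H) * exp (- c * real (k_sets ?q n B A))"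
      using transition_mass_decay_k_sets[OF C c n F(3,4,1,2)] transition_mass_commute[OF F(1,3)]
      by (simp add: mult.commute)
    ultimately have "(\<Sum>x\<in>F. mu x * ?U H x) \<le> sqrt (sum mu F * sum mu H) * ?e"
      by (simp add: kappa_def max_def)
    also have "\<dots> \<le> sqrt (\<alpha> * \<beta>) * ?e"
    proof -
      have "sum mu F \<le> \<alpha>" "sum mu H \<le> \<beta>"
        using sum_mu_le_mu_set[OF F(1,2)] sum_mu_le_mu_set[OF F(3,4)] \<alpha> \<beta> by simp_all
      then show ?thesis
        using \<alpha> by (intro mult_right_mono real_sqrt_le_mono mult_mono) (auto simp: sum_nonneg)
    qed
    finally show ?thesis .
  qed
  show ?thesis
    unfolding rhs
  proof (rule nn_integral_count_space_le_finite)
    show "countable (A \<times> B)"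
      using countable_vertices by (intro countable_SIGMA) (auto intro: countable_subset)
    fix Z assume Z: "finite Z" "Z \<subseteq> A \<times> B"
    have F: "finite (fst ` Z)" "fst ` Z \<subseteq> A" "finite (snd ` Z)" "snd ` Z \<subseteq> B"
      using Z by auto
    have "(\<Sum>(x, y)\<in>Z. ennreal (pn n x y * mu x * mu y)) = (\<Sum>p\<in>Z. ennreal (mu (fst p) * Pn n (fst p) (snd p)))"
      by (simp add: eq case_prod_beta)
    also have "\<dots> = ennreal (\<Sum>p\<in>Z. mu (fst p) * Pn n (fst p) (snd p))"
      using Pn0 by (intro sum_ennreal) auto
    \<comment> \<open>Enlarging \<open>Z\<close> to a rectangle turns the inner sums into
      probabilities of hitting a finite set at time \<open>n\<close>.\<close>
    also have "(\<Sum>p\<in>Z. mu (fst p) * Pn n (fst p) (snd p))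
        \<le> (\<Sum>p\<in>fst ` Z \<times> snd ` Z. mu (fst p) * Pn n (fst p) (snd p))"
      using F Pn0 by (intro sum_mono2) (force)+
    also have "\<dots> = (\<Sum>x\<in>fst ` Z. mu x * (\<Sum>y\<in>snd ` Z. Pn n x y))"
      by (simp add: sum.cartesian_product case_prod_beta sum_distrib_left)
    also have "\<dots> = (\<Sum>x\<in>fst ` Z. mu x * ?U (snd ` Z) x)"
      using F by (simp add: sum_Pn_eq_kop)
    also have "\<dots> \<le> sqrt (\<alpha> * \<beta>) * ?e" using main[OF F] .
    finally show "(\<Sum>(x, y)\<in>Z. ennreal (pn n x y * mu x * mu y)) \<le> ennreal (sqrt (\<alpha> * \<beta>) * ?e)"
      by (simp add: ennreal_leI)
  qed
qed

end

theorem theorem4p9: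
  fixes w :: "'a \<Rightarrow> 'a \<Rightarrow> real"
  assumes "weighted_graph w"
    and "weighted_graph.cond_Ebar w"
  shows "\<exists>q>0. \<exists>c>0. \<forall>A B. \<forall>n\<ge>1. A \<noteq> {} \<longrightarrow> B \<noteq> {} \<longrightarrow>
    (\<integral>\<^sup>+ (x, y). ennreal (weighted_graph.pn w n x y * weighted_graph.mu w x * weighted_graph.mu w y)
       \<partial>count_space (A \<times> B))
    \<le> ennreal_sqrt (weighted_graph.mu_set w A * weighted_graph.mu_set w B)
       * ennreal (exp (- c * real (weighted_graph.kappa w q n A B)))"
proof -
  interpret weighted_graph w by fact
  obtain C where C: "0 < C" "\<And>x R. 0 < R \<Longrightarrow> Ebar x R \<le> ennreal C * E x R"
    using assms(2) by (auto simp: cond_Ebar_def)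
  \<comment> \<open>\<open>ln 2\<close> serves the halving bound when \<open>K = 1\<close>, and
    \<open>1 / (16 * C)\<close> is the rate \<open>a / 8\<close> left over from
    \<open>q = 1 / (8 * C)\<close>.\<close>
  define c where "c = min (ln 2) (1 / (16 * C))"
  have c: "0 < c" "c \<le> ln 2" "c \<le> 1 / (16 * C)" using C by (auto simp: c_def)
  have C': "Ebar z (real r) \<le> ennreal C * E z (real r)" if "1 \<le> r" for z r
    using that by (intro C) auto
  show ?thesis
  proof (rule exI[of _ "1 / (8 * C)"], rule conjI[rotated], rule exI[of _ c], intro conjI allI impI)
    fix A B :: "'a set" and n :: nat
    assume "1 \<le> n" "A \<noteq> {}" "B \<noteq> {}"
    then show "(\<integral>\<^sup>+ (x, y). ennreal (pn n x y * mu x * mu y) \<partial>count_space (A \<times> B))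
      \<le> ennreal_sqrt (mu_set A * mu_set B) * ennreal (exp (- c * real (kappa (1 / (8 * C)) n A B)))"
      using transition_mass_decay_kappa[OF C(1) C' c(2,3)] by blast
  qed (use C c in auto)
qed

end
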